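(* Let $p$ be a prime and let $\Bbbk$ be a field of characteristic $p$. Let $\mathfrak L$ be the Petrogradsky–Shestakov–Zelmanov Lie algebra over $\Bbbk$, namely the self-similar Lie algebra generated by $d,v$ with self-similarity map given by $\phi(d)=\partial_x$ and $\phi(v)=1\otimes d+x^{p-1}\otimes v$, over $X=\Bbbk[x]/(x^p)$. Then $\mathfrak L$ belongs to $\mathsf{SL}$ but not to $\mathsf{EL}$.
   Context: Let $X$ be a finite-dimensional commutative algebra. For a Lie algebra $\mathfrak M$, the Lie algebra $(X\otimes\mathfrak M)\rtimes\operatorname{Der}(X)$ has bracket $[a\otimes m,b\otimes n]=ab\otimes[m,n]$, $[\delta,a\otimes m]=\delta(a)\otimes m$, and the commutator bracket on $\operatorname{Der}(X)$. A self-similar Lie algebra is a Lie algebra $\mathfrak M$ endowed with an injective Lie homomorphism $\phi\colon\mathfrak M\to(X\otimes\mathfrak M)\rtimes\operatorname{Der}(X)$. A generating set together with the values of $\phi$ on it defines a unique maximal self-similar Lie algebra. Explicitly, for generators $d,v$: let $\mathfrak F$ be the free Lie algebra on $d,v$, let $\psi\colon\mathfrak F\to(X\otimes\mathfrak F)\rtimes\operatorname{Der}(X)$ be the Lie homomorphism with the prescribed values on $d$ and $v$, put $N_0=0$, $N_{k+1}=\psi^{-1}(X\otimes N_k)$, $N=\bigcup_kN_k$; then $\mathfrak L=\mathfrak F/N$ and $\phi$ is the injective map induced by $\psi$. Here $\partial_x$ is the derivation of $X=\Bbbk[x]/(x^p)$ with $\partial_x(x)=1$. $\mathsf{EL}$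 is the smallest class of Lie algebras over $\Bbbk$ containing the finite-dimensional and the Abelian Lie algebras and closed under taking subalgebras, quotients, extensions, and directed unions. $\mathsf{SL}$ is the smallest class of Lie algebras over $\Bbbk$ containing the Lie algebras of subexponential growth and closed under the same four operations. For a Lie algebra generated by a finite-dimensional subspace $F$, put $B_1=F$ and $B_{n+1}=B_n+\langle[b,f]:b\in B_n,f\in F\rangle_{\Bbbk}$; it has subexponential growth if $\limsup_{n\to\infty}(\dim B_n)^{1/n}\le1$. *)

theory Defs
  imports
    "HOL-Library.Extended_Real"
    "HOL-Library.Function_Algebras"
    "HOL-Library.Product_Plus"
    "HOL-Computational_Algebra.Polynomial"
    "HOL-Computational_Algebra.Primes"
begin

section \<open>Lie algebras\<close>

text \<open>
  The underlying space of a Lie algebra is a linear subspace \<^term>\<open>lie_carrier M\<close> of a vector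
  space whose additive group is the type \<^typ>\<open>'v\<close>. The bracket is only relevant on the carrier.
\<close>

record ('k, 'v) lie_alg =
  lie_scale :: "'k \<Rightarrow> 'v \<Rightarrow> 'v"
  lie_carrier :: "'v set"
  lie_bracket :: "'v \<Rightarrow> 'v \<Rightarrow> 'v"

locale lie_algebra = vector_space "lie_scale M"
  for M :: "('k::field, 'v::ab_group_add) lie_alg" +
  assumes subspace_carrier: "subspace (lie_carrier M)"
    and bracket_closed:
      "\<lbrakk>x \<in> lie_carrier M; y \<in> lie_carrier M\<rbrakk> \<Longrightarrow> lie_bracket M x y \<in> lie_carrier M"
    and bracket_add_left:
      "\<lbrakk>x \<in> lie_carrier M; y \<in> lie_carrier M; z \<in> lie_carrier M\<rbrakk>
        \<Longrightarrow> lie_bracket M (x + y) z = lie_bracket M x z + lie_bracket M y z"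
    and bracket_add_right:
      "\<lbrakk>x \<in> lie_carrier M; y \<in> lie_carrier M; z \<in> lie_carrier M\<rbrakk>
        \<Longrightarrow> lie_bracket M x (y + z) = lie_bracket M x y + lie_bracket M x z"
    and bracket_scale_left:
      "\<lbrakk>x \<in> lie_carrier M; y \<in> lie_carrier M\<rbrakk>
        \<Longrightarrow> lie_bracket M (lie_scale M c x) y = lie_scale M c (lie_bracket M x y)"
    and bracket_scale_right:
      "\<lbrakk>x \<in> lie_carrier M; y \<in> lie_carrier M\<rbrakk>
        \<Longrightarrow> lie_bracket M x (lie_scale M c y) = lie_scale M c (lie_bracket M x y)"
    and bracket_self: "x \<in> lie_carrier M \<Longrightarrow> lie_bracket M x x = 0"
    and jacobi:
      "\<lbrakk>x \<in> lie_carrier M; y \<in> lie_carrier M; z \<in> lie_carrier M\<rbrakk>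
        \<Longrightarrow> lie_bracket M x (lie_bracket M y z) + lie_bracket M y (lie_bracket M z x)
          + lie_bracket M z (lie_bracket M x y) = 0"

definition lie_hom ::
  "('k::field, 'v::ab_group_add) lie_alg \<Rightarrow> ('k, 'w::ab_group_add) lie_alg \<Rightarrow> ('v \<Rightarrow> 'w) \<Rightarrow> bool"
  where "lie_hom M N f \<longleftrightarrow>
    f ` lie_carrier M \<subseteq> lie_carrier N \<and>
    (\<forall>x\<in>lie_carrier M. \<forall>y\<in>lie_carrier M. f (x + y) = f x + f y) \<and>
    (\<forall>c. \<forall>x\<in>lie_carrier M. f (lie_scale M c x) = lie_scale N c (f x)) \<and>
    (\<forall>x\<in>lie_carrier M. \<forall>y\<in>lie_carrier M. f (lie_bracket M x y) = lie_bracket N (f x) (f y))"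

definition lie_isomorphic ::
  "('k::field, 'v::ab_group_add) lie_alg \<Rightarrow> ('k, 'w::ab_group_add) lie_alg \<Rightarrow> bool"
  where "lie_isomorphic M N \<longleftrightarrow>
    (\<exists>f. lie_hom M N f \<and> bij_betw f (lie_carrier M) (lie_carrier N))"

definition lie_subalgebra :: "('k::field, 'v::ab_group_add) lie_alg \<Rightarrow> 'v set \<Rightarrow> bool"
  where "lie_subalgebra M S \<longleftrightarrow>
    module.subspace (lie_scale M) S \<and> S \<subseteq> lie_carrier M \<and>
    (\<forall>x\<in>S. \<forall>y\<in>S. lie_bracket M x y \<in> S)"

abbreviation lie_restrict :: "('k, 'v) lie_alg \<Rightarrow> 'v set \<Rightarrow> ('k, 'v) lie_alg"
  where "lie_restrict M S \<equiv> M\<lparr>lie_carrier := S\<rparr>"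

definition lie_kernel ::
  "('k, 'v) lie_alg \<Rightarrow> ('v \<Rightarrow> 'w::zero) \<Rightarrow> 'v set"
  where "lie_kernel M f = {x \<in> lie_carrier M. f x = 0}"

definition lie_abelian :: "('k, 'v::zero) lie_alg \<Rightarrow> bool"
  where "lie_abelian M \<longleftrightarrow>
    (\<forall>x\<in>lie_carrier M. \<forall>y\<in>lie_carrier M. lie_bracket M x y = 0)"

definition lie_finite_dim :: "('k::field, 'v::ab_group_add) lie_alg \<Rightarrow> bool"
  where "lie_finite_dim M \<longleftrightarrow>
    (\<exists>B. finite B \<and> lie_carrier M = module.span (lie_scale M) B)"


section \<open>Subexponential growth\<close>

fun lie_ball :: "('k::field, 'v::ab_group_add) lie_alg \<Rightarrow> 'v set \<Rightarrow> nat \<Rightarrow> 'v set"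
  where
    "lie_ball M F 0 = {0}"
  | "lie_ball M F (Suc 0) = F"
  | "lie_ball M F (Suc (Suc n)) =
       {b + c | b c. b \<in> lie_ball M F (Suc n) \<and>
          c \<in> module.span (lie_scale M)
                {lie_bracket M b' f | b' f. b' \<in> lie_ball M F (Suc n) \<and> f \<in> F}}"

text \<open>
  Only finitely generated Lie algebras have a growth. The growth type does not depend on
  the finite-dimensional generating subspace \<open>F\<close>, so asking for one such \<open>F\<close> is enough.
\<close>

definition lie_subexp_growth :: "('k::field, 'v::ab_group_add) lie_alg \<Rightarrow> bool"
  where "lie_subexp_growth M \<longleftrightarrow>
    (\<exists>F. (\<exists>B. finite B \<and> F = module.span (lie_scale M) B) \<and>
         F \<subseteq> lie_carrier M \<and>
         \<Inter>{S. lie_subalgebra M S \<and> F \<subseteq> S} = lie_carrier M \<and>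
         limsup (\<lambda>n. ereal (root n (real (vector_space.dim (lie_scale M) (lie_ball M F n))))) \<le> 1)"


section \<open>The classes EL and SL\<close>

text \<open>
  The smallest class of Lie algebras that contains those satisfying \<open>P\<close> and is closed under
  subalgebras, quotients, extensions and directed unions. Quotients are rendered as images of
  surjective homomorphisms, so the class is closed under isomorphism.

  All algebras involved live in one type \<^typ>\<open>'v\<close>, which plays the role of a universe. Every
  subalgebra and every quotient of an algebra in \<^typ>\<open>'v\<close> has a copy in \<^typ>\<open>'v\<close> (for a quotient,
  take a linear complement of the ideal).
\<close>

inductive lie_closure ::
  "(('k::field, 'v::ab_group_add) lie_alg \<Rightarrow> bool) \<Rightarrow> ('k, 'v) lie_alg \<Rightarrow> bool"
  for P :: "('k, 'v) lie_alg \<Rightarrow> bool"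
  where
    base: "\<lbrakk>lie_algebra M; P M\<rbrakk> \<Longrightarrow> lie_closure P M"
  | subalgebra: "\<lbrakk>lie_closure P M; lie_subalgebra M S\<rbrakk> \<Longrightarrow> lie_closure P (lie_restrict M S)"
  | quotient: "\<lbrakk>lie_closure P M; lie_algebra Q; lie_hom M Q f; f ` lie_carrier M = lie_carrier Q\<rbrakk>
      \<Longrightarrow> lie_closure P Q"
  | extension: "\<lbrakk>lie_algebra M; lie_hom M Q f; f ` lie_carrier M = lie_carrier Q;
        lie_closure P (lie_restrict M (lie_kernel M f)); lie_closure P Q\<rbrakk>
      \<Longrightarrow> lie_closure P M"
  | directed_union: "\<lbrakk>lie_algebra M; \<S> \<noteq> {};
        \<And>S. S \<in> \<S> \<Longrightarrow> lie_subalgebra M S;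
        \<And>S T. \<lbrakk>S \<in> \<S>; T \<in> \<S>\<rbrakk> \<Longrightarrow> \<exists>U\<in>\<S>. S \<subseteq> U \<and> T \<subseteq> U;
        lie_carrier M = \<Union>\<S>;
        \<And>S. S \<in> \<S> \<Longrightarrow> lie_closure P (lie_restrict M S)\<rbrakk>
      \<Longrightarrow> lie_closure P M"

definition EL :: "('k::field, 'v::ab_group_add) lie_alg set"
  where "EL = {M. lie_closure (\<lambda>A. lie_finite_dim A \<or> lie_abelian A) M}"

definition SL :: "('k::field, 'v::ab_group_add) lie_alg set"
  where "SL = {M. lie_closure lie_subexp_growth M}"


section \<open>Free Lie algebras\<close>

text \<open>Formal Lie expressions modulo the congruence generated by the Lie algebra axioms.\<close>

datatype ('k, 'g) lie_term =
    Gen 'g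
  | Zero
  | Add "('k, 'g) lie_term" "('k, 'g) lie_term"
  | Scale 'k "('k, 'g) lie_term"
  | Br "('k, 'g) lie_term" "('k, 'g) lie_term"

inductive lie_eq :: "('k::field, 'g) lie_term \<Rightarrow> ('k, 'g) lie_term \<Rightarrow> bool"
  where
    refl: "lie_eq s s"
  | sym: "lie_eq s t \<Longrightarrow> lie_eq t s"
  | trans: "\<lbrakk>lie_eq s t; lie_eq t u\<rbrakk> \<Longrightarrow> lie_eq s u"
  | cong_add: "\<lbrakk>lie_eq s s'; lie_eq t t'\<rbrakk> \<Longrightarrow> lie_eq (Add s t) (Add s' t')"
  | cong_scale: "lie_eq s s' \<Longrightarrow> lie_eq (Scale c s) (Scale c s')"
  | cong_br: "\<lbrakk>lie_eq s s'; lie_eq t t'\<rbrakk> \<Longrightarrow> lie_eq (Br s t) (Br s' t')"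
  | add_assoc: "lie_eq (Add (Add s t) u) (Add s (Add t u))"
  | add_comm: "lie_eq (Add s t) (Add t s)"
  | add_zero: "lie_eq (Add Zero s) s"
  | scale_zero: "lie_eq (Scale 0 s) Zero"
  | scale_one: "lie_eq (Scale 1 s) s"
  | scale_scale: "lie_eq (Scale a (Scale b s)) (Scale (a * b) s)"
  | scale_add_left: "lie_eq (Scale (a + b) s) (Add (Scale a s) (Scale b s))"
  | scale_add_right: "lie_eq (Scale a (Add s t)) (Add (Scale a s) (Scale a t))"
  | br_add_left: "lie_eq (Br (Add s t) u) (Add (Br s u) (Br t u))"
  | br_add_right: "lie_eq (Br u (Add s t)) (Add (Br u s) (Br u t))"
  | br_scale_left: "lie_eq (Br (Scale a s) t) (Scale a (Br s t))"
  | br_scale_right: "lie_eq (Br s (Scale a t)) (Scale a (Br s t))"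
  | br_self: "lie_eq (Br s s) Zero"
  | br_jacobi: "lie_eq (Add (Add (Br s (Br t u)) (Br t (Br u s))) (Br u (Br s t))) Zero"

quotient_type (overloaded) ('k, 'g) free_lie = "('k::field, 'g) lie_term" / lie_eq
  by (intro equivpI reflpI sympI transpI) (blast intro: lie_eq.refl lie_eq.sym lie_eq.trans)+

instantiation free_lie :: (field, type) ab_group_add
begin

lift_definition zero_free_lie :: "('a, 'b) free_lie" is Zero .
lift_definition plus_free_lie :: "('a, 'b) free_lie \<Rightarrow> ('a, 'b) free_lie \<Rightarrow> ('a, 'b) free_lie"
  is Add by (rule lie_eq.cong_add)
lift_definition uminus_free_lie :: "('a, 'b) free_lie \<Rightarrow> ('a, 'b) free_lie"
  is "Scale (-1)" by (rule lie_eq.cong_scale)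
definition minus_free_lie :: "('a, 'b) free_lie \<Rightarrow> ('a, 'b) free_lie \<Rightarrow> ('a, 'b) free_lie"
  where "minus_free_lie a b = a + (- b)"

instance
proof
  fix a b c :: "('a, 'b) free_lie"
  show "a + b + c = a + (b + c)" by transfer (rule lie_eq.add_assoc)
  show "a + b = b + a" by transfer (rule lie_eq.add_comm)
  show "0 + a = a" by transfer (rule lie_eq.add_zero)
  show "- a + a = 0"
  proof transfer
    fix s :: "('a, 'b) lie_term"
    have "lie_eq (Add (Scale (-1) s) s) (Add (Scale (-1) s) (Scale 1 s))"
      by (intro lie_eq.cong_add lie_eq.refl lie_eq.sym[OF lie_eq.scale_one])
    moreover have "lie_eq (Add (Scale (-1) s) (Scale 1 s)) (Scale (-1 + 1) s)"
      by (intro lie_eq.sym[OF lie_eq.scale_add_left])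
    ultimately show "lie_eq (Add (Scale (-1) s) s) Zero"
      using lie_eq.scale_zero[of s] by (auto intro: lie_eq.trans)
  qed
  show "a - b = a + - b" by (rule minus_free_lie_def)
qed

end

lift_definition free_gen :: "'g \<Rightarrow> ('k::field, 'g) free_lie" is Gen .
lift_definition free_scale :: "'k::field \<Rightarrow> ('k, 'g) free_lie \<Rightarrow> ('k, 'g) free_lie"
  is Scale by (rule lie_eq.cong_scale)
lift_definition free_bracket ::
  "('k::field, 'g) free_lie \<Rightarrow> ('k, 'g) free_lie \<Rightarrow> ('k, 'g) free_lie"
  is Br by (rule lie_eq.cong_br)

definition free_lie_alg :: "('k::field, ('k, 'g) free_lie) lie_alg"
  where "free_lie_alg = \<lparr>lie_scale = free_scale, lie_carrier = UNIV, lie_bracket = free_bracket\<rparr>"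

lemma free_lie_alg_simps [simp]:
  "lie_scale free_lie_alg = free_scale"
  "lie_carrier free_lie_alg = UNIV"
  "lie_bracket free_lie_alg = free_bracket"
  by (simp_all add: free_lie_alg_def)

lemma lie_algebra_free_lie_alg: "lie_algebra (free_lie_alg :: ('k::field, ('k, 'g) free_lie) lie_alg)"
proof -
  have vs: "vector_space (free_scale :: 'k \<Rightarrow> ('k, 'g) free_lie \<Rightarrow> ('k, 'g) free_lie)"
    by unfold_locales
      (transfer, blast intro: lie_eq.scale_add_right lie_eq.scale_add_left lie_eq.scale_scale lie_eq.scale_one)+
  interpret vector_space "free_scale :: 'k \<Rightarrow> ('k, 'g) free_lie \<Rightarrow> ('k, 'g) free_lie" by (rule vs)
  show ?thesis
    apply (rule lie_algebra.intro)
     apply (simp add: vs)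
    apply (rule lie_algebra_axioms.intro; simp)
          apply (transfer, rule lie_eq.br_add_left)
         apply (transfer, rule lie_eq.br_add_right)
        apply (transfer, rule lie_eq.br_scale_left)
       apply (transfer, rule lie_eq.br_scale_right)
      apply (transfer, rule lie_eq.br_self)
     apply (transfer, rule lie_eq.br_jacobi)
    done
qed

primrec lie_eval ::
  "('k::field, 'v::ab_group_add) lie_alg \<Rightarrow> ('g \<Rightarrow> 'v) \<Rightarrow> ('k, 'g) lie_term \<Rightarrow> 'v"
  where
    "lie_eval M g (Gen x) = g x"
  | "lie_eval M g Zero = 0"
  | "lie_eval M g (Add s t) = lie_eval M g s + lie_eval M g t"
  | "lie_eval M g (Scale c s) = lie_scale M c (lie_eval M g s)"
  | "lie_eval M g (Br s t) = lie_bracket M (lie_eval M g s) (lie_eval M g t)"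

text \<open>The homomorphism from the free Lie algebra with prescribed values \<open>g\<close> on the generators.\<close>

definition free_lie_ext ::
  "('k::field, 'v::ab_group_add) lie_alg \<Rightarrow> ('g \<Rightarrow> 'v) \<Rightarrow> ('k, 'g) free_lie \<Rightarrow> 'v"
  where "free_lie_ext M g a = lie_eval M g (rep_free_lie a)"

lemma free_lie_abs_cases: "\<exists>t. a = abs_free_lie t"
  by (metis Quotient3_abs_rep Quotient3_free_lie)

context lie_algebra
begin

lemma carrier_zero [simp]: "0 \<in> lie_carrier M"
  and carrier_add [simp]: "\<lbrakk>x \<in> lie_carrier M; y \<in> lie_carrier M\<rbrakk> \<Longrightarrow> x + y \<in> lie_carrier M"
  and carrier_scale [simp]: "x \<in> lie_carrier M \<Longrightarrow> lie_scale M c x \<in> lie_carrier M"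
  using subspace_carrier by (auto simp: subspace_def)

declare bracket_closed [simp]

lemma lie_eval_closed [simp]:
  assumes "range g \<subseteq> lie_carrier M"
  shows "lie_eval M g t \<in> lie_carrier M"
  using assms by (induction t) auto

lemma lie_eval_cong:
  assumes "range g \<subseteq> lie_carrier M" "lie_eq s t"
  shows "lie_eval M g s = lie_eval M g t"
  using assms(2,1)
  by (induction rule: lie_eq.induct)
     (simp_all add: algebra_simps bracket_add_left bracket_add_right bracket_scale_left
        bracket_scale_right bracket_self jacobi[unfolded add.assoc])

lemma free_lie_ext_abs:
  assumes "range g \<subseteq> lie_carrier M"
  shows "free_lie_ext M g (abs_free_lie t) = lie_eval M g t"
  unfolding free_lie_ext_def
  by (intro lie_eval_cong assms) (metis Quotient3_free_lie Quotient3_rep_abs lie_eq.refl)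

lemma lie_hom_free_lie_ext:
  assumes "range g \<subseteq> lie_carrier M"
  shows "lie_hom free_lie_alg M (free_lie_ext M g)"
proof -
  note ex = free_lie_abs_cases
  have add: "free_lie_ext M g (a + b) = free_lie_ext M g a + free_lie_ext M g b" for a b
    using ex[of a] ex[of b] by (auto simp: free_lie_ext_abs[OF assms] plus_free_lie.abs_eq)
  have br: "free_lie_ext M g (free_bracket a b) = lie_bracket M (free_lie_ext M g a) (free_lie_ext M g b)" for a b
    using ex[of a] ex[of b] by (auto simp: free_lie_ext_abs[OF assms] free_bracket.abs_eq)
  have sc: "free_lie_ext M g (free_scale c a) = lie_scale M c (free_lie_ext M g a)" for a c
    using ex[of a] by (auto simp: free_lie_ext_abs[OF assms] free_scale.abs_eq)
  show ?thesis
    using add br sc assms unfolding lie_hom_def by (auto simp: free_lie_ext_def)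
qed

lemma free_lie_ext_gen:
  assumes "range g \<subseteq> lie_carrier M"
  shows "free_lie_ext M g (free_gen x) = g x"
  by (simp add: free_lie_ext_abs[OF assms] free_gen.abs_eq)

lemma free_lie_ext_unique:
  assumes "range g \<subseteq> lie_carrier M" "lie_hom free_lie_alg M f" "\<And>x. f (free_gen x) = g x"
  shows "f = (free_lie_ext M g :: ('k, 'c) free_lie \<Rightarrow> 'v)"
proof
  fix a :: "('k, 'c) free_lie"
  obtain t where a: "a = abs_free_lie t"
    using free_lie_abs_cases by blast
  have add: "f (x + y) = f x + f y" for x y using assms(2) by (simp add: lie_hom_def)
  have zero: "f 0 = 0" using add[of 0 0] by simp
  have "f (abs_free_lie t) = lie_eval M g t"
  proof (induction t)
    case (Gen x)
    then show ?case using assms(3)[of x] by (simp add: free_gen.abs_eq)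
  next
    case Zero
    then show ?case using zero by (simp add: zero_free_lie.abs_eq)
  next
    case (Add s t)
    then show ?case using add by (simp flip: plus_free_lie.abs_eq)
  next
    case (Scale c t)
    then show ?case using assms(2) by (simp add: lie_hom_def flip: free_scale.abs_eq)
  next
    case (Br s t)
    then show ?case using assms(2) by (simp add: lie_hom_def flip: free_bracket.abs_eq)
  qed
  then show "f a = free_lie_ext M g a"
    by (simp add: a free_lie_ext_abs[OF assms(1)])
qed

end


section \<open>The algebra \<open>X = k[x]/(x\<^sup>p)\<close> and its derivations\<close>

text \<open>Here \<open>p\<close> is the characteristic of the field \<^typ>\<open>'k\<close>.\<close>

quotient_type (overloaded) 'k trunc_poly = "'k::field poly" / "\<lambda>a b. monom 1 CHAR('k) dvd a - b"
proof (intro equivpI reflpI sympI transpI)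
  fix a b c :: "'k poly"
  show "monom 1 CHAR('k) dvd a - a" by simp
  show "monom 1 CHAR('k) dvd b - a" if "monom 1 CHAR('k) dvd a - b"
    using that by (metis dvd_minus_iff minus_diff_eq)
  show "monom 1 CHAR('k) dvd a - c"
    if "monom 1 CHAR('k) dvd a - b" "monom 1 CHAR('k) dvd b - c"
    using dvd_add[OF that] by simp
qed

instantiation trunc_poly :: (field) "{comm_ring, comm_monoid_mult}"
begin

lift_definition zero_trunc_poly :: "'a trunc_poly" is 0 .
lift_definition one_trunc_poly :: "'a trunc_poly" is 1 .
lift_definition plus_trunc_poly :: "'a trunc_poly \<Rightarrow> 'a trunc_poly \<Rightarrow> 'a trunc_poly" is "(+)"
  by (metis add_diff_add dvd_add)
lift_definition minus_trunc_poly :: "'a trunc_poly \<Rightarrow> 'a trunc_poly \<Rightarrow> 'a trunc_poly" is "(-)"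
proof -
  fix a b c d :: "'a poly"
  assume "monom 1 CHAR('a) dvd a - b" "monom 1 CHAR('a) dvd c - d"
  from dvd_diff[OF this] show "monom 1 CHAR('a) dvd a - c - (b - d)"
    by (simp add: algebra_simps)
qed
lift_definition uminus_trunc_poly :: "'a trunc_poly \<Rightarrow> 'a trunc_poly" is uminus
  by (metis dvd_minus_iff minus_diff_minus)
lift_definition times_trunc_poly :: "'a trunc_poly \<Rightarrow> 'a trunc_poly \<Rightarrow> 'a trunc_poly" is "(*)"
proof -
  fix a b c d :: "'a poly"
  assume *: "monom 1 CHAR('a) dvd a - b" "monom 1 CHAR('a) dvd c - d"
  have "a * c - b * d = (a - b) * c + b * (c - d)" by (simp add: algebra_simps)
  with * show "monom 1 CHAR('a) dvd a * c - b * d" by simp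
qed

instance
  by standard (transfer; simp add: algebra_simps)+

end

lift_definition xvar :: "'k::field trunc_poly" is "monom 1 1" .

lift_definition xscale :: "'k::field \<Rightarrow> 'k trunc_poly \<Rightarrow> 'k trunc_poly" is smult
  by (metis dvd_smult smult_diff_right)

text \<open>The coefficient of \<open>x\<^sup>i\<close> in the basis \<open>1, x, \<dots>, x\<^sup>p\<^sup>-\<^sup>1\<close> of \<open>X\<close>.\<close>

lift_definition xcoeff :: "'k::field trunc_poly \<Rightarrow> nat \<Rightarrow> 'k"
  is "\<lambda>a i. coeff (a mod monom 1 CHAR('k)) i"
  by (metis mod_eq_dvd_iff)

definition Der :: "('k::field trunc_poly \<Rightarrow> 'k trunc_poly) set"
  where "Der = {\<delta>. Vector_Spaces.linear xscale xscale \<delta> \<and> (\<forall>a b. \<delta> (a * b) = \<delta> a * b + a * \<delta> b)}"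

lift_definition partial_x :: "'k::field trunc_poly \<Rightarrow> 'k trunc_poly" is pderiv
proof -
  fix a b :: "'k poly"
  assume "monom 1 CHAR('k) dvd a - b"
  then obtain q where q: "a - b = monom 1 CHAR('k) * q" by (auto simp: dvd_def)
  have "pderiv a - pderiv b = pderiv (monom 1 CHAR('k) * q)"
    by (simp flip: q add: pderiv_diff)
  also have "\<dots> = monom 1 CHAR('k) * pderiv q"
    by (simp add: pderiv_mult pderiv_monom)
  finally show "monom 1 CHAR('k) dvd pderiv a - pderiv b" by simp
qed

lemma vector_space_xscale: "vector_space (xscale :: 'k::field \<Rightarrow> _)"
  by unfold_locales (transfer; simp add: smult_add_left smult_add_right)+

lemma xscale_mult_left: "xscale c a * b = xscale c (a * b)"
  and xscale_mult_right: "a * xscale c b = xscale c (a * b)"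
  by (transfer; simp)+

lemma linear_xscaleI:
  assumes "\<And>a b. f (a + b) = f a + f b" "\<And>c a. f (xscale c a) = xscale c (f a)"
  shows "Vector_Spaces.linear xscale xscale f"
  by (intro Vector_Spaces.linear.intro vector_space_xscale module_hom.intro
      module_hom_axioms.intro assms vector_space_xscale[folded module_iff_vector_space])

lemma Der_iff:
  "\<delta> \<in> Der \<longleftrightarrow> (\<forall>a b. \<delta> (a + b) = \<delta> a + \<delta> b) \<and> (\<forall>c a. \<delta> (xscale c a) = xscale c (\<delta> a)) \<and>
     (\<forall>a b. \<delta> (a * b) = \<delta> a * b + a * \<delta> b)"
proof -
  have "\<delta> (a + b) = \<delta> a + \<delta> b" "\<delta> (xscale c a) = xscale c (\<delta> a)"
    if "Vector_Spaces.linear xscale xscale \<delta>" for a b c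
    using that module_hom.add module_hom.scale unfolding module_hom_iff_linear[symmetric] by blast+
  then show ?thesis
    unfolding Der_def by (auto intro: linear_xscaleI)
qed

lemma DerD:
  assumes "\<delta> \<in> Der"
  shows "\<delta> (a + b) = \<delta> a + \<delta> b" "\<delta> (xscale c a) = xscale c (\<delta> a)"
    "\<delta> (a * b) = \<delta> a * b + a * \<delta> b" "\<delta> 0 = 0" "\<delta> (a - b) = \<delta> a - \<delta> b"
    "\<delta> (sum f A) = (\<Sum>i\<in>A. \<delta> (f i))"
proof -
  show *: "\<delta> (a + b) = \<delta> a + \<delta> b" for a b using assms by (simp add: Der_iff)
  show "\<delta> (xscale c a) = xscale c (\<delta> a)" "\<delta> (a * b) = \<delta> a * b + a * \<delta> b"
    using assms by (simp_all add: Der_iff)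
  show **: "\<delta> 0 = 0" using *[of 0 0] by simp
  show "\<delta> (a - b) = \<delta> a - \<delta> b" using *[of "a - b" b] by (simp add: algebra_simps)
  show "\<delta> (sum f A) = (\<Sum>i\<in>A. \<delta> (f i))"
    by (induction A rule: infinite_finite_induct) (auto simp: * **)
qed

lemma xvar_power: "xvar ^ n = abs_trunc_poly (monom 1 n)"
  by (induction n)
     (simp_all add: one_trunc_poly.abs_eq xvar.abs_eq times_trunc_poly.abs_eq mult_monom)

lemma xcoeff_add: "xcoeff (a + b) i = xcoeff a i + xcoeff b i"
  by transfer (simp add: poly_mod_add_left)

lemma xcoeff_xscale: "xcoeff (xscale c a) i = c * xcoeff a i"
  by transfer (simp add: mod_smult_left)

lemma xcoeff_0 [simp]: "xcoeff 0 i = 0"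
  by transfer simp

lemma xcoeff_sum: "xcoeff (sum f A) i = (\<Sum>a\<in>A. xcoeff (f a) i)"
  by (induction A rule: infinite_finite_induct) (auto simp: xcoeff_add)

lemma xcoeff_beyond:
  fixes a :: "'k::field trunc_poly"
  assumes "CHAR('k) \<le> i"
  shows "xcoeff a i = 0"
  using assms
proof (transfer fixing: i)
  fix a :: "'k poly"
  assume i: "CHAR('k) \<le> i"
  show "coeff (a mod monom 1 CHAR('k)) i = 0"
  proof (cases "CHAR('k) = 0")
    case False
    then have "degree (a mod monom 1 CHAR('k)) < CHAR('k) \<or> a mod monom 1 CHAR('k) = 0"
      using degree_mod_less[of "monom 1 CHAR('k)" a] by (auto simp: degree_monom_eq)
    with i show ?thesis by (auto intro: coeff_eq_0)
  qed (simp add: monom_0 flip: one_pCons)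
qed

lemma xcoeff_xvar_power:
  assumes "i < CHAR('k)"
  shows "xcoeff ((xvar :: 'k::field trunc_poly) ^ i) j = (if i = j then 1 else 0)"
  using assms by (simp add: xvar_power xcoeff.abs_eq mod_poly_less degree_monom_eq)

lemma Der_closed:
  fixes \<delta> \<epsilon> :: "'a::field trunc_poly \<Rightarrow> 'a trunc_poly"
  shows "(\<lambda>a. 0 :: 'a trunc_poly) \<in> Der"
    and "\<lbrakk>\<delta> \<in> Der; \<epsilon> \<in> Der\<rbrakk> \<Longrightarrow> (\<lambda>a. \<delta> a + \<epsilon> a) \<in> Der"
    and "\<delta> \<in> Der \<Longrightarrow> (\<lambda>a. xscale c (\<delta> a)) \<in> Der"
    and "\<lbrakk>\<delta> \<in> Der; \<epsilon> \<in> Der\<rbrakk> \<Longrightarrow> (\<lambda>a. \<delta> (\<epsilon> a) - \<epsilon> (\<delta> a)) \<in> Der"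
proof -
  interpret X: vector_space "xscale :: 'a \<Rightarrow> _" by (rule vector_space_xscale)
  show "(\<lambda>a. 0 :: 'a trunc_poly) \<in> Der" by (simp add: Der_iff)
  show "(\<lambda>a. \<delta> a + \<epsilon> a) \<in> Der" if "\<delta> \<in> Der" "\<epsilon> \<in> Der"
    using that by (auto simp: Der_iff algebra_simps X.scale_right_distrib)
  show "(\<lambda>a. xscale c (\<delta> a)) \<in> Der" if "\<delta> \<in> Der"
    using that by (auto simp: Der_iff xscale_mult_left xscale_mult_right X.scale_right_distrib mult.commute[of c])
  show "(\<lambda>a. \<delta> (\<epsilon> a) - \<epsilon> (\<delta> a)) \<in> Der" if "\<delta> \<in> Der" "\<epsilon> \<in> Der"
    using that by (auto simp: Der_iff algebra_simps X.scale_right_diff_distrib)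
qed

lemma trunc_poly_eqI:
  assumes "\<And>i. xcoeff a i = xcoeff b i"
  shows "a = b"
  using assms by transfer (simp add: poly_eq_iff flip: mod_eq_dvd_iff)

lemma trunc_poly_expand:
  fixes a :: "'k::field trunc_poly"
  shows "a = (\<Sum>i<CHAR('k). xscale (xcoeff a i) (xvar ^ i))"
proof (rule trunc_poly_eqI)
  fix j
  have "xcoeff (\<Sum>i<CHAR('k). xscale (xcoeff a i) (xvar ^ i)) j
      = (\<Sum>i<CHAR('k). if i = j then xcoeff a j else 0)"
    unfolding xcoeff_sum by (intro sum.cong refl) (auto simp: xcoeff_xscale xcoeff_xvar_power)
  also have "\<dots> = xcoeff a j"
    using xcoeff_beyond[of j a] by auto
  finally show "xcoeff a j = xcoeff (\<Sum>i<CHAR('k). xscale (xcoeff a i) (xvar ^ i)) j" by simp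
qed

lemma partial_x_xvar: "partial_x xvar = 1"
  by transfer (simp add: pderiv_monom monom_0 flip: one_pCons)

lemma partial_x_Der: "partial_x \<in> Der"
  unfolding Der_iff
  by (intro conjI allI; transfer; simp add: pderiv_add pderiv_smult pderiv_mult algebra_simps)


section \<open>The Lie algebra \<open>(X \<otimes> M) \<rtimes> Der X\<close>\<close>

text \<open>
  Since \<open>1, x, \<dots>, x\<^sup>p\<^sup>-\<^sup>1\<close> is a basis of \<open>X\<close>, the elements of \<open>X \<otimes> M\<close> are represented by
  their coefficient families: \<open>m\<close> stands for the sum of \<open>x\<^sup>i \<otimes> m i\<close> over \<open>i < p\<close>, with \<open>m i = 0\<close>
  for \<open>i \<ge> p\<close>. For a subset \<open>S\<close> of \<open>M\<close>, the set of such families with all coefficients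
  in \<open>S\<close> is \<open>X \<otimes> S\<close>.
\<close>

definition tensor_set :: "nat \<Rightarrow> 'v::zero set \<Rightarrow> (nat \<Rightarrow> 'v) set"
  where "tensor_set p S = {m. (\<forall>i<p. m i \<in> S) \<and> (\<forall>i\<ge>p. m i = 0)}"

definition tensor :: "('k::field, 'v::ab_group_add) lie_alg \<Rightarrow> 'k trunc_poly \<Rightarrow> 'v \<Rightarrow> nat \<Rightarrow> 'v"
  where "tensor M a u = (\<lambda>i. lie_scale M (xcoeff a i) u)"

text \<open>
  The bilinear extension of \<open>[a \<otimes> u, b \<otimes> v] = ab \<otimes> [u, v]\<close>, and the linear extension of
  \<open>\<delta> (a \<otimes> u) = \<delta> a \<otimes> u\<close>; see the lemmas \<open>tensor_bracket_tensor\<close> and \<open>tensor_act_tensor\<close> below.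
\<close>

definition tensor_bracket ::
  "('k::field, 'v::ab_group_add) lie_alg \<Rightarrow> (nat \<Rightarrow> 'v) \<Rightarrow> (nat \<Rightarrow> 'v) \<Rightarrow> nat \<Rightarrow> 'v"
  where "tensor_bracket M m n =
    (\<Sum>i<CHAR('k). \<Sum>j<CHAR('k). tensor M (xvar ^ i * xvar ^ j) (lie_bracket M (m i) (n j)))"

definition tensor_act ::
  "('k::field, 'v::ab_group_add) lie_alg \<Rightarrow> ('k trunc_poly \<Rightarrow> 'k trunc_poly) \<Rightarrow> (nat \<Rightarrow> 'v) \<Rightarrow> nat \<Rightarrow> 'v"
  where "tensor_act M \<delta> m = (\<Sum>i<CHAR('k). tensor M (\<delta> (xvar ^ i)) (m i))"

definition semidirect ::
  "('k::field, 'v::ab_group_add) lie_alg \<Rightarrow>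
   ('k, (nat \<Rightarrow> 'v) \<times> ('k trunc_poly \<Rightarrow> 'k trunc_poly)) lie_alg"
  where "semidirect M = \<lparr>
    lie_scale = (\<lambda>c (m, \<delta>). (\<lambda>i. lie_scale M c (m i), \<lambda>a. xscale c (\<delta> a))),
    lie_carrier = tensor_set CHAR('k) (lie_carrier M) \<times> Der,
    lie_bracket = (\<lambda>(m, \<delta>) (n, \<epsilon>).
      (tensor_bracket M m n + tensor_act M \<delta> n - tensor_act M \<epsilon> m, \<lambda>a. \<delta> (\<epsilon> a) - \<epsilon> (\<delta> a)))\<rparr>"


lemma semidirect_simps:
  "lie_scale (semidirect M) c (m, \<delta>) = (\<lambda>i. lie_scale M c (m i), \<lambda>a. xscale c (\<delta> a))"
  "lie_carrier (semidirect (M :: ('k::field, 'v::ab_group_add) lie_alg)) = tensor_set CHAR('k) (lie_carrier M) \<times> Der"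
  "lie_bracket (semidirect M) (m, \<delta>) (n, \<epsilon>) =
      (tensor_bracket M m n + tensor_act M \<delta> n - tensor_act M \<epsilon> m, \<lambda>a. \<delta> (\<epsilon> a) - \<epsilon> (\<delta> a))"
  by (simp_all add: semidirect_def)

lemma sum_fun_apply: "sum f A i = (\<Sum>a\<in>A. f a i)" for f :: "'a \<Rightarrow> 'b \<Rightarrow> 'c::comm_monoid_add"
  by (induction A rule: infinite_finite_induct) auto

context lie_algebra
begin

abbreviation "tensor_carrier \<equiv> tensor_set CHAR('k) (lie_carrier M)"

lemma carrier_neg [simp]: "x \<in> lie_carrier M \<Longrightarrow> - x \<in> lie_carrier M"
  and carrier_diff [simp]: "\<lbrakk>x \<in> lie_carrier M; y \<in> lie_carrier M\<rbrakk> \<Longrightarrow> x - y \<in> lie_carrier M"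
  using subspace_carrier by (auto intro: subspace_neg subspace_diff)

lemma carrier_sum: "(\<And>i. i \<in> A \<Longrightarrow> f i \<in> lie_carrier M) \<Longrightarrow> sum f A \<in> lie_carrier M"
  using subspace_carrier by (rule subspace_sum)

lemma T_zero [simp]: "0 \<in> tensor_carrier"
  and T_add [simp]: "\<lbrakk>m \<in> tensor_carrier; n \<in> tensor_carrier\<rbrakk> \<Longrightarrow> m + n \<in> tensor_carrier"
  and T_diff [simp]: "\<lbrakk>m \<in> tensor_carrier; n \<in> tensor_carrier\<rbrakk> \<Longrightarrow> m - n \<in> tensor_carrier"
  and T_scale: "m \<in> tensor_carrier \<Longrightarrow> (\<lambda>i. lie_scale M c (m i)) \<in> tensor_carrier"
  by (auto simp: tensor_set_def)

lemma T_sum: "(\<And>i. i \<in> A \<Longrightarrow> f i \<in> tensor_carrier) \<Longrightarrow> sum f A \<in> tensor_carrier"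
  by (induction A rule: infinite_finite_induct) auto

lemma T_tensor [simp]: "u \<in> lie_carrier M \<Longrightarrow> tensor M a u \<in> tensor_carrier"
  by (auto simp: tensor_set_def tensor_def xcoeff_beyond)

lemma T_nth: "m \<in> tensor_carrier \<Longrightarrow> m i \<in> lie_carrier M"
  by (cases "i < CHAR('k)") (auto simp: tensor_set_def)

lemma tensor_add_left: "tensor M (a + b) u = tensor M a u + tensor M b u"
  and tensor_add_right: "tensor M a (u + v) = tensor M a u + tensor M a v"
  and tensor_xscale: "tensor M (xscale c a) u = tensor M a (lie_scale M c u)"
  and tensor_scale: "tensor M a (lie_scale M c u) = (\<lambda>i. lie_scale M c (tensor M a u i))"
  and tensor_zero_left [simp]: "tensor M 0 u = 0"
  and tensor_zero_right [simp]: "tensor M a 0 = 0"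
  by (auto simp: tensor_def fun_eq_iff xcoeff_add xcoeff_xscale scale_left_distrib
      scale_right_distrib mult.commute)

lemma tensor_diff_left: "tensor M (a - b) u = tensor M a u - tensor M b u"
  using tensor_add_left[of "a - b" b u] by (simp add: algebra_simps)

lemma tensor_sum_left: "tensor M (sum f A) u = (\<Sum>i\<in>A. tensor M (f i) u)"
  by (induction A rule: infinite_finite_induct) (auto simp: tensor_add_left)

lemma tensor_expand:
  assumes "m \<in> tensor_carrier"
  shows "m = (\<Sum>i<CHAR('k). tensor M (xvar ^ i) (m i))"
proof
  fix j
  have "(\<Sum>i<CHAR('k). tensor M (xvar ^ i) (m i)) j = (\<Sum>i<CHAR('k). if i = j then m j else 0)"
    unfolding sum_fun_apply by (intro sum.cong refl) (auto simp: tensor_def xcoeff_xvar_power)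
  also have "\<dots> = m j"
    using assms by (auto simp: tensor_set_def)
  finally show "m j = (\<Sum>i<CHAR('k). tensor M (xvar ^ i) (m i)) j" by simp
qed

lemma tensor_induct [consumes 1, case_names zero add tensor]:
  assumes "m \<in> tensor_carrier" "P 0" "\<And>m n. \<lbrakk>m \<in> tensor_carrier; n \<in> tensor_carrier; P m; P n\<rbrakk> \<Longrightarrow> P (m + n)"
    "\<And>a u. u \<in> lie_carrier M \<Longrightarrow> P (tensor M a u)"
  shows "P m"
proof -
  have "sum f A \<in> tensor_carrier \<and> P (sum f A)" if "\<And>i. f i \<in> tensor_carrier \<and> P (f i)" for f :: "nat \<Rightarrow> nat \<Rightarrow> 'v" and A
    using that by (induction A rule: infinite_finite_induct) (simp_all add: assms(2,3))
  from this[of "\<lambda>i. tensor M (xvar ^ i) (m i)" "{..<CHAR('k)}"]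
  have "P (\<Sum>i<CHAR('k). tensor M (xvar ^ i) (m i))"
    using T_tensor[OF T_nth[OF assms(1)]] assms(4)[OF T_nth[OF assms(1)]] by blast
  then show ?thesis unfolding tensor_expand[OF assms(1), symmetric] .
qed

lemma bracket_zero_left [simp]: "x \<in> lie_carrier M \<Longrightarrow> lie_bracket M 0 x = 0"
  using bracket_scale_left[of 0 x 0] by simp

lemma bracket_zero_right [simp]: "x \<in> lie_carrier M \<Longrightarrow> lie_bracket M x 0 = 0"
  using bracket_scale_right[of x 0 0] by simp

lemma bracket_swap:
  assumes "x \<in> lie_carrier M" "y \<in> lie_carrier M"
  shows "lie_bracket M x y = - lie_bracket M y x"
proof -
  have "lie_bracket M (x + y) (x + y) = lie_bracket M x y + lie_bracket M y x"
    using assms bracket_self[of x] bracket_self[of y] by (simp add: bracket_add_left bracket_add_right)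
  then show ?thesis using bracket_self[of "x + y"] assms by (simp add: eq_neg_iff_add_eq_0)
qed

lemma tensor_bracket_closed [simp]: "\<lbrakk>m \<in> tensor_carrier; n \<in> tensor_carrier\<rbrakk> \<Longrightarrow> tensor_bracket M m n \<in> tensor_carrier"
  unfolding tensor_bracket_def by (intro T_sum T_tensor bracket_closed T_nth)

lemma tensor_bracket_add_left:
  "\<lbrakk>m \<in> tensor_carrier; n \<in> tensor_carrier; r \<in> tensor_carrier\<rbrakk> \<Longrightarrow> tensor_bracket M (m + n) r = tensor_bracket M m r + tensor_bracket M n r"
  by (simp add: tensor_bracket_def T_nth bracket_add_left tensor_add_right sum.distrib)

lemma tensor_bracket_add_right:
  "\<lbrakk>m \<in> tensor_carrier; n \<in> tensor_carrier; r \<in> tensor_carrier\<rbrakk> \<Longrightarrow> tensor_bracket M r (m + n) = tensor_bracket M r m + tensor_bracket M r n"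
  by (simp add: tensor_bracket_def T_nth bracket_add_right tensor_add_right sum.distrib)

lemma tensor_bracket_zero [simp]:
  assumes "m \<in> tensor_carrier"
  shows "tensor_bracket M m 0 = 0" "tensor_bracket M 0 m = 0"
  using tensor_bracket_add_right[of 0 0 m] tensor_bracket_add_left[of 0 0 m] assms by auto

lemma tensor_bracket_diff_left:
  "\<lbrakk>m \<in> tensor_carrier; n \<in> tensor_carrier; r \<in> tensor_carrier\<rbrakk> \<Longrightarrow> tensor_bracket M (m - n) r = tensor_bracket M m r - tensor_bracket M n r"
  using tensor_bracket_add_left[of "m - n" n r] by (simp add: algebra_simps)

lemma tensor_bracket_diff_right:
  "\<lbrakk>m \<in> tensor_carrier; n \<in> tensor_carrier; r \<in> tensor_carrier\<rbrakk> \<Longrightarrow> tensor_bracket M r (m - n) = tensor_bracket M r m - tensor_bracket M r n"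
  using tensor_bracket_add_right[of "m - n" n r] by (simp add: algebra_simps)

lemma scale_sum_fun:
  "(\<lambda>i. lie_scale M c (sum f A i)) = (\<Sum>j\<in>A. (\<lambda>i. lie_scale M c (f j i)))"
  by (simp add: fun_eq_iff sum_fun_apply scale_sum_right)

lemma tensor_bracket_scale_left:
  "\<lbrakk>m \<in> tensor_carrier; n \<in> tensor_carrier\<rbrakk> \<Longrightarrow>
    tensor_bracket M (\<lambda>i. lie_scale M c (m i)) n = (\<lambda>i. lie_scale M c (tensor_bracket M m n i))"
  by (simp add: tensor_bracket_def T_nth bracket_scale_left tensor_scale scale_sum_fun)

lemma tensor_bracket_scale_right:
  "\<lbrakk>m \<in> tensor_carrier; n \<in> tensor_carrier\<rbrakk> \<Longrightarrow>
    tensor_bracket M m (\<lambda>i. lie_scale M c (n i)) = (\<lambda>i. lie_scale M c (tensor_bracket M m n i))"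
  by (simp add: tensor_bracket_def T_nth bracket_scale_right tensor_scale scale_sum_fun)

lemma tensor_bracket_tensor:
  assumes "u \<in> lie_carrier M" "v \<in> lie_carrier M"
  shows "tensor_bracket M (tensor M a u) (tensor M b v) = tensor M (a * b) (lie_bracket M u v)"
proof -
  have "tensor_bracket M (tensor M a u) (tensor M b v) =
      (\<Sum>i<CHAR('k). \<Sum>j<CHAR('k).
        tensor M (xscale (xcoeff a i) (xvar ^ i) * xscale (xcoeff b j) (xvar ^ j)) (lie_bracket M u v))"
    unfolding tensor_bracket_def tensor_def[of M a u] tensor_def[of M b v]
    using assms by (simp add: bracket_scale_left bracket_scale_right xscale_mult_left
        xscale_mult_right tensor_xscale mult.commute)
  also have "\<dots> = tensor M ((\<Sum>i<CHAR('k). xscale (xcoeff a i) (xvar ^ i)) *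
      (\<Sum>j<CHAR('k). xscale (xcoeff b j) (xvar ^ j))) (lie_bracket M u v)"
    by (simp add: sum_product tensor_sum_left)
  also have "\<dots> = tensor M (a * b) (lie_bracket M u v)"
    by (simp flip: trunc_poly_expand)
  finally show ?thesis .
qed

lemma tensor_act_closed [simp]: "m \<in> tensor_carrier \<Longrightarrow> tensor_act M \<delta> m \<in> tensor_carrier"
  unfolding tensor_act_def by (intro T_sum T_tensor T_nth)

lemma tensor_act_add: "tensor_act M \<delta> (m + n) = tensor_act M \<delta> m + tensor_act M \<delta> n"
  by (simp add: tensor_act_def tensor_add_right sum.distrib)

lemma tensor_act_zero [simp]: "tensor_act M \<delta> 0 = 0"
  by (simp add: tensor_act_def)

lemma tensor_act_diff: "tensor_act M \<delta> (m - n) = tensor_act M \<delta> m - tensor_act M \<delta> n"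
  using tensor_act_add[of \<delta> "m - n" n] by (simp add: algebra_simps)

lemma tensor_act_scale:
  "tensor_act M \<delta> (\<lambda>i. lie_scale M c (m i)) = (\<lambda>i. lie_scale M c (tensor_act M \<delta> m i))"
  by (simp add: tensor_act_def tensor_scale scale_sum_fun)

lemma tensor_act_add_der: "tensor_act M (\<lambda>a. \<delta> a + \<epsilon> a) m = tensor_act M \<delta> m + tensor_act M \<epsilon> m"
  and tensor_act_diff_der: "tensor_act M (\<lambda>a. \<delta> a - \<epsilon> a) m = tensor_act M \<delta> m - tensor_act M \<epsilon> m"
  and tensor_act_scale_der:
    "tensor_act M (\<lambda>a. xscale c (\<delta> a)) m = (\<lambda>i. lie_scale M c (tensor_act M \<delta> m i))"
  by (simp_all add: tensor_act_def tensor_add_left tensor_diff_left sum.distrib sum_subtractf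
      tensor_xscale tensor_scale scale_sum_fun)

lemma tensor_act_tensor:
  assumes "\<delta> \<in> Der"
  shows "tensor_act M \<delta> (tensor M a u) = tensor M (\<delta> a) u"
proof -
  have "tensor_act M \<delta> (tensor M a u)
      = tensor M (\<Sum>i<CHAR('k). \<delta> (xscale (xcoeff a i) (xvar ^ i))) u"
    unfolding tensor_act_def tensor_def[of M a u]
    using assms by (simp add: tensor_sum_left DerD tensor_xscale)
  also have "\<dots> = tensor M (\<delta> a) u"
    unfolding DerD(6)[OF assms, symmetric] trunc_poly_expand[symmetric] ..
  finally show ?thesis .
qed

lemma tensor_bracket_swap:
  assumes "m \<in> tensor_carrier" "n \<in> tensor_carrier"
  shows "tensor_bracket M m n = - tensor_bracket M n m"
proof (rule tensor_induct[of m "\<lambda>m. tensor_bracket M m n = - tensor_bracket M n m"])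
  fix a u
  assume u: "u \<in> lie_carrier M"
  show "tensor_bracket M (tensor M a u) n = - tensor_bracket M n (tensor M a u)"
  proof (rule tensor_induct[of n "\<lambda>n. tensor_bracket M (tensor M a u) n = - tensor_bracket M n (tensor M a u)"])
    fix b v
    assume v: "v \<in> lie_carrier M"
    have "tensor M (b * a) (- w) = - tensor M (b * a) w" for w
      by (simp add: tensor_def fun_eq_iff)
    with u v show "tensor_bracket M (tensor M a u) (tensor M b v) =
        - tensor_bracket M (tensor M b v) (tensor M a u)"
      by (simp add: tensor_bracket_tensor bracket_swap[of u v] mult.commute)
  qed (use assms u in \<open>simp_all add: tensor_bracket_add_left tensor_bracket_add_right\<close>)
qed (use assms in \<open>simp_all add: tensor_bracket_add_left tensor_bracket_add_right\<close>)

lemma tensor_bracket_self: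
  assumes "m \<in> tensor_carrier"
  shows "tensor_bracket M m m = 0"
proof (rule tensor_induct[of m "\<lambda>m. tensor_bracket M m m = 0"])
  fix m n
  assume "m \<in> tensor_carrier" "n \<in> tensor_carrier" "tensor_bracket M m m = 0" "tensor_bracket M n n = 0"
  then show "tensor_bracket M (m + n) (m + n) = 0"
    using tensor_bracket_swap[of m n] by (simp add: tensor_bracket_add_left tensor_bracket_add_right)
qed (use assms in \<open>simp_all add: tensor_bracket_tensor bracket_self\<close>)

lemma tensor_jacobi:
  assumes "m \<in> tensor_carrier" "n \<in> tensor_carrier" "r \<in> tensor_carrier"
  shows "tensor_bracket M m (tensor_bracket M n r) + tensor_bracket M n (tensor_bracket M r m)
    + tensor_bracket M r (tensor_bracket M m n) = 0"
proof -
  define J where "J m n r = tensor_bracket M m (tensor_bracket M n r) +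
    tensor_bracket M n (tensor_bracket M r m) + tensor_bracket M r (tensor_bracket M m n)" for m n r
  have add: "J (m + m') n r = J m n r + J m' n r" "J m (n + n') r = J m n r + J m n' r"
    "J m n (r + r') = J m n r + J m n r'"
    if "m \<in> tensor_carrier" "m' \<in> tensor_carrier" "n \<in> tensor_carrier" "n' \<in> tensor_carrier" "r \<in> tensor_carrier" "r' \<in> tensor_carrier" for m m' n n' r r'
    using that unfolding J_def
    by (simp_all add: tensor_bracket_add_left tensor_bracket_add_right algebra_simps)
  have zero: "J 0 n r = 0" "J m 0 r = 0" "J m n 0 = 0" if "m \<in> tensor_carrier" "n \<in> tensor_carrier" "r \<in> tensor_carrier" for m n r
    using that unfolding J_def by simp_all
  have 1: "J (tensor M a u) (tensor M b v) (tensor M c w) = 0"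
    if "u \<in> lie_carrier M" "v \<in> lie_carrier M" "w \<in> lie_carrier M" for a b c u v w
  proof -
    have "b * (c * a) = a * (b * c)" "c * (a * b) = a * (b * c)" by (simp_all add: ac_simps)
    with that jacobi[of u v w] show ?thesis
      by (simp add: J_def tensor_bracket_tensor flip: tensor_add_right)
  qed
  have 2: "J (tensor M a u) (tensor M b v) r = 0"
    if "u \<in> lie_carrier M" "v \<in> lie_carrier M" "r \<in> tensor_carrier" for a b u v r
    by (rule tensor_induct[of r "\<lambda>r. J (tensor M a u) (tensor M b v) r = 0"])
       (use that in \<open>simp_all add: 1 add zero\<close>)
  have 3: "J (tensor M a u) n r = 0" if "u \<in> lie_carrier M" "n \<in> tensor_carrier" "r \<in> tensor_carrier" for a u n r
    by (rule tensor_induct[of n "\<lambda>n. J (tensor M a u) n r = 0"])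
       (use that in \<open>simp_all add: 2 add zero\<close>)
  have "J m n r = 0"
    by (rule tensor_induct[of m "\<lambda>m. J m n r = 0"])
       (use assms in \<open>simp_all add: 3 add zero\<close>)
  then show ?thesis by (simp add: J_def)
qed

lemma tensor_act_bracket:
  assumes "\<delta> \<in> Der" "m \<in> tensor_carrier" "n \<in> tensor_carrier"
  shows "tensor_act M \<delta> (tensor_bracket M m n) =
    tensor_bracket M (tensor_act M \<delta> m) n + tensor_bracket M m (tensor_act M \<delta> n)"
proof -
  define E where "E m n \<longleftrightarrow> tensor_act M \<delta> (tensor_bracket M m n) =
    tensor_bracket M (tensor_act M \<delta> m) n + tensor_bracket M m (tensor_act M \<delta> n)" for m n
  have 1: "E (tensor M a u) (tensor M b v)"
    if "u \<in> lie_carrier M" "v \<in> lie_carrier M" for a b u v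
    using that assms(1)
    by (simp add: E_def tensor_bracket_tensor tensor_act_tensor DerD(3) tensor_add_left)
  have 2: "E (tensor M a u) n" if "u \<in> lie_carrier M" "n \<in> tensor_carrier" for a u n
    by (rule tensor_induct[of n "\<lambda>n. E (tensor M a u) n"])
       (use that 1 in \<open>auto simp add: E_def tensor_bracket_add_right tensor_act_add\<close>)
  have "E m n"
    by (rule tensor_induct[of m "\<lambda>m. E m n"])
       (use assms 2 in \<open>auto simp add: E_def tensor_bracket_add_left tensor_act_add\<close>)
  then show ?thesis by (simp add: E_def)
qed

lemma tensor_act_compose:
  assumes "\<delta> \<in> Der" "\<epsilon> \<in> Der" "m \<in> tensor_carrier"
  shows "tensor_act M \<delta> (tensor_act M \<epsilon> m) = tensor_act M (\<lambda>a. \<delta> (\<epsilon> a)) m"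
proof (rule tensor_induct[of m "\<lambda>m. tensor_act M \<delta> (tensor_act M \<epsilon> m) = tensor_act M (\<lambda>a. \<delta> (\<epsilon> a)) m"])
  fix a u
  assume "u \<in> lie_carrier M"
  have "tensor_act M (\<lambda>a. \<delta> (\<epsilon> a)) (tensor M a u)
      = tensor M (\<Sum>i<CHAR('k). \<delta> (\<epsilon> (xscale (xcoeff a i) (xvar ^ i)))) u"
    unfolding tensor_act_def tensor_def[of M a u]
    using assms by (simp add: tensor_sum_left DerD tensor_xscale)
  also have "\<dots> = tensor M (\<delta> (\<epsilon> a)) u"
    unfolding DerD(6)[OF assms(1), symmetric] DerD(6)[OF assms(2), symmetric]
      trunc_poly_expand[symmetric] ..
  finally show "tensor_act M \<delta> (tensor_act M \<epsilon> (tensor M a u)) = tensor_act M (\<lambda>a. \<delta> (\<epsilon> a)) (tensor M a u)"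
    using assms by (simp add: tensor_act_tensor)
qed (use assms in \<open>simp_all add: tensor_act_add\<close>)

lemma lie_algebra_semidirect: "lie_algebra (semidirect M)"
proof -
  interpret X: vector_space "xscale :: 'k \<Rightarrow> _" by (rule vector_space_xscale)
  have vs: "vector_space (lie_scale (semidirect M))"
    by unfold_locales
      (auto simp: semidirect_simps fun_eq_iff scale_left_distrib scale_right_distrib
        X.scale_left_distrib X.scale_right_distrib)
  interpret V: vector_space "lie_scale (semidirect M)" by (rule vs)
  have [simp]: "\<delta> + \<epsilon> = (\<lambda>a. \<delta> a + \<epsilon> a)" "\<delta> - \<epsilon> = (\<lambda>a. \<delta> a - \<epsilon> a)" "0 = (\<lambda>a. 0 :: 'k trunc_poly)"
    for \<delta> \<epsilon> :: "'k trunc_poly \<Rightarrow> 'k trunc_poly"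
    by auto
  show ?thesis
  proof (rule lie_algebra.intro[OF vs], rule lie_algebra_axioms.intro, goal_cases)
    case 1
    show ?case
      unfolding V.subspace_def
      by (auto simp: semidirect_simps zero_prod_def T_scale intro!: Der_closed)
  next
    case (2 x y)
    then show ?case
      by (cases x; cases y) (auto simp: semidirect_simps intro!: Der_closed)
  next
    case (3 x y z)
    then show ?case
      by (cases x; cases y; cases z)
         (auto simp: semidirect_simps tensor_bracket_add_left tensor_act_add tensor_act_add_der
           DerD fun_eq_iff algebra_simps)
  next
    case (4 x y z)
    then show ?case
      by (cases x; cases y; cases z)
         (auto simp: semidirect_simps tensor_bracket_add_right tensor_act_add tensor_act_add_der
           DerD fun_eq_iff algebra_simps)
  next
    case (5 x y c)
    then show ?case
      by (cases x; cases y)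
         (auto simp: semidirect_simps tensor_bracket_scale_left tensor_act_scale tensor_act_scale_der
           DerD fun_eq_iff X.scale_right_diff_distrib scale_right_distrib scale_right_diff_distrib)
  next
    case (6 x y c)
    then show ?case
      by (cases x; cases y)
         (auto simp: semidirect_simps tensor_bracket_scale_right tensor_act_scale tensor_act_scale_der
           DerD fun_eq_iff X.scale_right_diff_distrib scale_right_distrib scale_right_diff_distrib)
  next
    case (7 x)
    then show ?case
      by (cases x) (auto simp: semidirect_simps tensor_bracket_self zero_prod_def)
  next
    case (8 x y z)
    obtain m \<delta> n \<epsilon> r \<zeta> where [simp]: "x = (m, \<delta>)" "y = (n, \<epsilon>)" "z = (r, \<zeta>)"
      by (cases x; cases y; cases z)
    have [simp]: "m \<in> tensor_carrier" "n \<in> tensor_carrier" "r \<in> tensor_carrier" and D: "\<delta> \<in> Der" "\<epsilon> \<in> Der" "\<zeta> \<in> Der"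
      using 8 by (auto simp: semidirect_simps)
    note J = tensor_jacobi[of m n r]
    note S = tensor_bracket_swap[of "tensor_act M \<delta> n" r] tensor_bracket_swap[of "tensor_act M \<delta> r" n]
      tensor_bracket_swap[of "tensor_act M \<epsilon> m" r] tensor_bracket_swap[of "tensor_act M \<epsilon> r" m]
      tensor_bracket_swap[of "tensor_act M \<zeta> m" n] tensor_bracket_swap[of "tensor_act M \<zeta> n" m]
    show ?case
      using D J
      by (simp add: semidirect_simps zero_prod_def fun_eq_iff DerD tensor_bracket_add_right
          tensor_bracket_diff_right tensor_act_add tensor_act_diff tensor_act_bracket
          tensor_act_diff_der tensor_act_compose S algebra_simps)
  qed
qed

end


section \<open>The Petrogradsky--Shestakov--Zelmanov Lie algebra\<close>

text \<open>
  The generators \<open>d\<close> and \<open>v\<close>. The map \<open>psz_psi\<close> is the Lie homomorphism on the free Lie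
  algebra with \<open>d \<mapsto> \<partial>\<^sub>x\<close> and \<open>v \<mapsto> 1 \<otimes> d + x\<^sup>p\<^sup>-\<^sup>1 \<otimes> v\<close>; the algebra is the quotient by the
  union of the ideals \<open>psz_N k\<close>, where \<open>psz_N (k + 1)\<close> is the preimage of \<open>X \<otimes> psz_N k\<close>.
\<close>

datatype psz_gen = Dgen | Vgen

definition psz_psi ::
  "('k::field, psz_gen) free_lie \<Rightarrow>
   (nat \<Rightarrow> ('k, psz_gen) free_lie) \<times> ('k trunc_poly \<Rightarrow> 'k trunc_poly)"
  where "psz_psi = free_lie_ext (semidirect free_lie_alg)
    (\<lambda>g. case g of
        Dgen \<Rightarrow> (0, partial_x)
      | Vgen \<Rightarrow> (tensor free_lie_alg 1 (free_gen Dgen)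
                + tensor free_lie_alg (xvar ^ (CHAR('k) - 1)) (free_gen Vgen), 0))"

primrec psz_N :: "nat \<Rightarrow> ('k::field, psz_gen) free_lie set"
  where
    "psz_N 0 = {0}"
  | "psz_N (Suc k) = psz_psi -` (tensor_set CHAR('k) (psz_N k) \<times> {0})"

definition psz_ideal :: "('k::field, psz_gen) free_lie set"
  where "psz_ideal = (\<Union>k. psz_N k)"

lemma psz_psi:
  "lie_hom free_lie_alg (semidirect free_lie_alg) (psz_psi :: ('k::field, psz_gen) free_lie \<Rightarrow> _)"
  "psz_psi (free_gen Dgen :: ('k, psz_gen) free_lie) = (0, partial_x)"
  "psz_psi (free_gen Vgen :: ('k, psz_gen) free_lie) =
    (tensor free_lie_alg 1 (free_gen Dgen)
      + tensor free_lie_alg (xvar ^ (CHAR('k) - 1)) (free_gen Vgen), 0)"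
proof -
  let ?F = "free_lie_alg :: ('k, ('k, psz_gen) free_lie) lie_alg"
  let ?g = "\<lambda>g. case g of
        Dgen \<Rightarrow> (0, partial_x)
      | Vgen \<Rightarrow> (tensor ?F 1 (free_gen Dgen)
                + tensor ?F (xvar ^ (CHAR('k) - 1)) (free_gen Vgen), 0)"
  interpret F: lie_algebra ?F by (rule lie_algebra_free_lie_alg)
  interpret S: lie_algebra "semidirect ?F" by (rule F.lie_algebra_semidirect)
  have "(0 :: 'k trunc_poly \<Rightarrow> 'k trunc_poly) \<in> Der"
    using Der_closed(1) by (simp add: zero_fun_def)
  have g: "range ?g \<subseteq> lie_carrier (semidirect ?F)"
  proof (rule image_subsetI)
    fix g
    show "?g g \<in> lie_carrier (semidirect ?F)"
      using F.T_zero F.T_add[OF F.T_tensor F.T_tensor] \<open>(0 :: 'k trunc_poly \<Rightarrow> 'k trunc_poly) \<in> Der\<close>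
      by (cases g) (simp_all add: semidirect_simps partial_x_Der)
  qed
  show "lie_hom ?F (semidirect ?F) psz_psi"
    unfolding psz_psi_def by (rule S.lie_hom_free_lie_ext[OF g])
  show "psz_psi (free_gen Dgen :: ('k, psz_gen) free_lie) = (0, partial_x)"
    "psz_psi (free_gen Vgen :: ('k, psz_gen) free_lie) =
      (tensor ?F 1 (free_gen Dgen) + tensor ?F (xvar ^ (CHAR('k) - 1)) (free_gen Vgen), 0)"
    unfolding psz_psi_def by (simp_all only: S.free_lie_ext_gen[OF g] psz_gen.case)
qed

lemma
  fixes a b :: "('k::field, psz_gen) free_lie"
  shows psz_psi_add: "psz_psi (a + b) = psz_psi a + psz_psi b"
  and psz_psi_scale: "psz_psi (free_scale c a) = lie_scale (semidirect free_lie_alg) c (psz_psi a)"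
  and psz_psi_bracket:
    "psz_psi (free_bracket a b) = lie_bracket (semidirect free_lie_alg) (psz_psi a) (psz_psi b)"
  and psz_psi_closed: "psz_psi a \<in> lie_carrier (semidirect free_lie_alg)"
  and psz_psi_0: "psz_psi (0 :: ('k, psz_gen) free_lie) = 0"
proof -
  show *: "psz_psi (a + b) = psz_psi a + psz_psi b" for a b :: "('k, psz_gen) free_lie"
    using psz_psi(1)[where ?'k = 'k] by (simp add: lie_hom_def)
  show "psz_psi (free_scale c a) = lie_scale (semidirect free_lie_alg) c (psz_psi a)"
    "psz_psi (free_bracket a b) = lie_bracket (semidirect free_lie_alg) (psz_psi a) (psz_psi b)"
    "psz_psi a \<in> lie_carrier (semidirect free_lie_alg)"
    using psz_psi(1)[where ?'k = 'k] by (auto simp: lie_hom_def)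
  show "psz_psi (0 :: ('k, psz_gen) free_lie) = 0"
    using *[of 0 0] by simp
qed

lemma psz_N_ideal:
  fixes a b c :: "('k::field, psz_gen) free_lie"
  shows "(0 :: ('k, psz_gen) free_lie) \<in> psz_N k" "a \<in> psz_N k \<Longrightarrow> b \<in> psz_N k \<Longrightarrow> a + b \<in> psz_N k"
    "a \<in> psz_N k \<Longrightarrow> free_scale r a \<in> psz_N k"
    "a \<in> psz_N k \<Longrightarrow> free_bracket c a \<in> psz_N k"
proof (induction k arbitrary: a b c r)
  case 0
  interpret F: lie_algebra "free_lie_alg :: ('k, ('k, psz_gen) free_lie) lie_alg"
    by (rule lie_algebra_free_lie_alg)
  {
    case 1
    then show ?case by simp
  next
    case 2
    then show ?case by simp
  next
    case 3
    then show ?case using F.scale_zero_right by simp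
  next
    case 4
    then show ?case using F.bracket_zero_right by simp
  }
next
  case (Suc k)
  let ?F = "free_lie_alg :: ('k, ('k, psz_gen) free_lie) lie_alg"
  interpret F: lie_algebra ?F by (rule lie_algebra_free_lie_alg)
  have tens: "tensor ?F x u i \<in> psz_N k" if "u \<in> psz_N k" for x u i
    using Suc.IH(3)[OF that] by (simp add: tensor_def)
  have sums: "sum f A \<in> psz_N k" if "\<And>i. i \<in> A \<Longrightarrow> f i \<in> psz_N k"
    for A :: "nat set" and f :: "nat \<Rightarrow> ('k, psz_gen) free_lie"
    using that by (induction A rule: infinite_finite_induct) (simp_all add: Suc.IH(1) Suc.IH(2))
  {
    case 1
    then show ?case using Suc.IH(1) by (auto simp: psz_psi_0 zero_prod_def tensor_set_def)
  next
    case 2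
    then show ?case using Suc.IH(2) by (auto simp: psz_psi_add tensor_set_def)
  next
    case 3
    interpret X: vector_space "xscale :: 'k \<Rightarrow> _" by (rule vector_space_xscale)
    obtain m where m: "psz_psi a = (m, 0)" "m \<in> tensor_set CHAR('k) (psz_N k)"
      using 3 by auto
    with Suc.IH(3) show ?case
      using F.scale_zero_right
      by (auto simp: psz_psi_scale semidirect_simps tensor_set_def fun_eq_iff)
  next
    case 4
    obtain m where m: "psz_psi a = (m, 0)" "m \<in> tensor_set CHAR('k) (psz_N k)"
      using 4 by auto
    obtain n \<delta> where n: "psz_psi c = (n, \<delta>)" by (cases "psz_psi c")
    have nT: "n \<in> tensor_set CHAR('k) (lie_carrier ?F)" and D: "\<delta> \<in> Der"
      using psz_psi_closed[of c] by (simp_all only: n semidirect_simps mem_Times_iff fst_conv snd_conv)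
    have mT: "m \<in> tensor_set CHAR('k) (lie_carrier ?F)"
      using m(2) by (simp add: tensor_set_def)
    have zero: "tensor_act ?F 0 n = 0"
      using F.tensor_act_scale_der[of 0 "\<lambda>_. 0" n] F.tensor_zero_left
      by (simp add: tensor_act_def)
    have "tensor_bracket ?F n m i + tensor_act ?F \<delta> m i \<in> psz_N k" if "i < CHAR('k)" for i
    proof (rule Suc.IH(2))
      show "tensor_bracket ?F n m i \<in> psz_N k"
        unfolding tensor_bracket_def sum_fun_apply
        using m(2) by (intro sums tens) (simp add: tensor_set_def Suc.IH(4))
      show "tensor_act ?F \<delta> m i \<in> psz_N k"
        unfolding tensor_act_def sum_fun_apply
        using m(2) by (intro sums tens) (simp add: tensor_set_def)
    qed
    moreover have "tensor_bracket ?F n m i + tensor_act ?F \<delta> m i = 0" if "i \<ge> CHAR('k)" for i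
      using F.tensor_bracket_closed[OF nT mT] F.tensor_act_closed[OF mT, of \<delta>] that
      by (simp add: tensor_set_def)
    ultimately have "tensor_bracket ?F n m + tensor_act ?F \<delta> m \<in> tensor_set CHAR('k) (psz_N k)"
      by (simp add: tensor_set_def)
    then show ?case
      using DerD(4)[OF D]
      by (auto simp: psz_psi_bracket m n semidirect_simps zero fun_eq_iff)
  }
qed

lemma psz_N_mono: "k \<le> l \<Longrightarrow> psz_N k \<subseteq> psz_N l"
proof (rule lift_Suc_mono_le[of psz_N])
  show "psz_N n \<subseteq> psz_N (Suc n)" for n
  proof (induction n)
    case 0
    show ?case using psz_N_ideal(1)[of "Suc 0"] by simp
  next
    case (Suc n)
    then show ?case by (auto simp: tensor_set_def)
  qed
qed

lemma psz_ideal: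
  fixes a b c :: "('k::field, psz_gen) free_lie"
  shows "(0 :: ('k, psz_gen) free_lie) \<in> psz_ideal" "a \<in> psz_ideal \<Longrightarrow> b \<in> psz_ideal \<Longrightarrow> a + b \<in> psz_ideal"
  "a \<in> psz_ideal \<Longrightarrow> free_scale r a \<in> psz_ideal"
  "a \<in> psz_ideal \<Longrightarrow> free_bracket c a \<in> psz_ideal"
  "a \<in> psz_ideal \<Longrightarrow> free_bracket a c \<in> psz_ideal"
  "a \<in> psz_ideal \<Longrightarrow> - a \<in> psz_ideal"
proof -
  interpret F: lie_algebra "free_lie_alg :: ('k, ('k, psz_gen) free_lie) lie_alg"
    by (rule lie_algebra_free_lie_alg)
  have neg: "- x = free_scale (-1) x" for x :: "('k, psz_gen) free_lie"
    using F.scale_minus_left[of 1 x] F.scale_one[of x] by simp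
  show "(0 :: ('k, psz_gen) free_lie) \<in> psz_ideal" using psz_N_ideal(1) by (auto simp: psz_ideal_def)
  show "a + b \<in> psz_ideal" if "a \<in> psz_ideal" "b \<in> psz_ideal"
  proof -
    obtain k l where "a \<in> psz_N k" "b \<in> psz_N l" using \<open>a \<in> _\<close> \<open>b \<in> _\<close> by (auto simp: psz_ideal_def)
    then have "a \<in> psz_N (max k l)" "b \<in> psz_N (max k l)"
      using psz_N_mono[of k "max k l"] psz_N_mono[of l "max k l"] by auto
    then show ?thesis using psz_N_ideal(2) by (auto simp: psz_ideal_def)
  qed
  show sc: "free_scale r a \<in> psz_ideal" if "a \<in> psz_ideal" for r and a :: "('k, psz_gen) free_lie"
    using that psz_N_ideal(3) by (auto simp: psz_ideal_def)
  show br: "free_bracket c a \<in> psz_ideal" if "a \<in> psz_ideal"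
    using that psz_N_ideal(4) by (auto simp: psz_ideal_def)
  show "- a \<in> psz_ideal" if "a \<in> psz_ideal"
    using sc[OF that] by (simp add: neg)
  show "free_bracket a c \<in> psz_ideal" if "a \<in> psz_ideal"
    using sc[OF br[OF that], of "-1"] F.bracket_swap[of a c] by (simp flip: neg)
qed

quotient_type (overloaded) 'k psz =
  "('k::field, psz_gen) free_lie" / "\<lambda>a b. a - b \<in> psz_ideal"
proof (intro equivpI reflpI sympI transpI)
  fix a b c :: "('k, psz_gen) free_lie"
  show "a - a \<in> psz_ideal" by (simp add: psz_ideal)
  show "b - a \<in> psz_ideal" if "a - b \<in> psz_ideal" using psz_ideal(6)[OF that] by simp
  show "a - c \<in> psz_ideal" if "a - b \<in> psz_ideal" "b - c \<in> psz_ideal"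
    using psz_ideal(2)[OF that] by simp
qed

instantiation psz :: (field) ab_group_add
begin

lift_definition zero_psz :: "'a psz" is 0 .
lift_definition plus_psz :: "'a psz \<Rightarrow> 'a psz \<Rightarrow> 'a psz" is "(+)"
  using psz_ideal(2) by (metis add_diff_add)
lift_definition minus_psz :: "'a psz \<Rightarrow> 'a psz \<Rightarrow> 'a psz" is "(-)"
proof -
  fix a b c d :: "('a, psz_gen) free_lie"
  assume "a - b \<in> psz_ideal" "c - d \<in> psz_ideal"
  from psz_ideal(2)[OF this(1) psz_ideal(6)[OF this(2)]]
  show "a - c - (b - d) \<in> psz_ideal" by (simp add: algebra_simps)
qed
lift_definition uminus_psz :: "'a psz \<Rightarrow> 'a psz" is uminus
  using psz_ideal(6) by (metis minus_diff_minus)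

instance
  by standard (transfer; simp add: psz_ideal)+

end

lift_definition psz_scale :: "'k::field \<Rightarrow> 'k psz \<Rightarrow> 'k psz" is free_scale
proof -
  fix r :: 'k and a b :: "('k, psz_gen) free_lie"
  assume *: "a - b \<in> psz_ideal"
  interpret F: lie_algebra "free_lie_alg :: ('k, ('k, psz_gen) free_lie) lie_alg"
    by (rule lie_algebra_free_lie_alg)
  show "free_scale r a - free_scale r b \<in> psz_ideal"
    using psz_ideal(3)[OF *, of r] F.scale_right_diff_distrib by simp
qed

lift_definition psz_bracket :: "'k::field psz \<Rightarrow> 'k psz \<Rightarrow> 'k psz" is free_bracket
proof -
  fix a b c d :: "('k, psz_gen) free_lie"
  assume *: "a - b \<in> psz_ideal" "c - d \<in> psz_ideal"
  interpret F: lie_algebra "free_lie_alg :: ('k, ('k, psz_gen) free_lie) lie_alg"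
    by (rule lie_algebra_free_lie_alg)
  have "free_bracket a c - free_bracket b d = free_bracket (a - b) c + free_bracket b (c - d)"
    using F.bracket_add_left[of "a - b" b c] F.bracket_add_right[of b "c - d" d] by (simp add: algebra_simps)
  then show "free_bracket a c - free_bracket b d \<in> psz_ideal"
    using psz_ideal(2)[OF psz_ideal(5)[OF *(1)] psz_ideal(4)[OF *(2)]] by simp
qed

definition psz_alg :: "('k::field, 'k psz) lie_alg"
  where "psz_alg = \<lparr>lie_scale = psz_scale, lie_carrier = UNIV, lie_bracket = psz_bracket\<rparr>"

lemma lie_algebra_psz_alg: "lie_algebra (psz_alg :: ('k::field, 'k psz) lie_alg)"
proof -
  interpret F: lie_algebra "free_lie_alg :: ('k, ('k, psz_gen) free_lie) lie_alg"
    by (rule lie_algebra_free_lie_alg)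
  note F = F.scale_left_distrib F.scale_right_distrib F.scale_scale F.bracket_add_left
    F.bracket_add_right F.bracket_scale_left F.bracket_scale_right F.bracket_self F.jacobi
    F.scale_one
  note F' = F[simplified]
  have vs: "vector_space (psz_scale :: 'k \<Rightarrow> _)"
    by unfold_locales (transfer; simp add: F' psz_ideal)+
  interpret vector_space "psz_scale :: 'k \<Rightarrow> _" by (rule vs)
  show ?thesis
    apply (rule lie_algebra.intro)
     apply (simp add: vs psz_alg_def)
    apply (rule lie_algebra_axioms.intro; simp add: psz_alg_def)
          apply (transfer, simp add: F' psz_ideal)+
    done
qed

end

theory Submission
  imports Defs
begin

text \<open>
  Write the self-similarity map as \<open>\<phi> a = c a \<partial>\<^sub>x + (\<Sum>i<p. x\<^sup>i \<otimes> \<phi> i a)\<close>. Evaluation at \<open>x = 0\<close>, that is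
  \<open>\<phi> 0\<close>, is a homomorphism from the proper ideal \<open>ker c\<close> onto \<open>L\<close>; so \<open>L\<close> is infinite dimensional, and
  \<open>I \<mapsto> \<phi> 0 ` (I \<inter> ker c)\<close> maps ideals to ideals that are subquotients of them. Give \<open>d\<close> the
  weight \<open>1\<close> and \<open>v\<close> the weight \<open>\<lambda>\<close> with \<open>\<lambda>\<^sup>2 = \<lambda> + p - 1\<close>. Then \<open>\<phi> i\<close> maps weight at most \<open>\<lambda> + E\<close> to
  weight at most \<open>\<lambda> + E / \<lambda>\<close>, and elements of weight less than \<open>\<lambda> + 1\<close> are combinations of \<open>d\<close> and \<open>v\<close>.

  Since \<open>\<phi>\<close> is injective, the dimension of the part of weight at most \<open>\<lambda> + E\<close> is at most one plus \<open>p\<close>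
  times that of weight at most \<open>\<lambda> + E / \<lambda>\<close>; hence the growth is polynomial. The contraction also shows
  that iterating \<open>I \<mapsto> \<phi> 0 ` (I \<inter> ker c)\<close> on a nonzero ideal reaches \<open>L\<close>, so every nonzero ideal has
  \<open>L\<close> as a subquotient. For such an \<open>L\<close>, which is finitely generated, infinite dimensional and not
  Abelian, the algebras without \<open>L\<close> as a subquotient form a class containing the generators of \<open>EL\<close>
  and closed under the four operations.
\<close>

section \<open>Ideals and subquotients\<close>

text \<open>Brackets from one side suffice, since the bracket is anticommutative.\<close>

definition lie_ideal :: "('k::field, 'v::ab_group_add) lie_alg \<Rightarrow> 'v set \<Rightarrow> bool"
  where "lie_ideal M I \<longleftrightarrow> module.subspace (lie_scale M) I \<and> I \<subseteq> lie_carrier M \<and>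
    (\<forall>x\<in>lie_carrier M. \<forall>y\<in>I. lie_bracket M x y \<in> I)"

text \<open>A homomorphism onto \<open>L\<close> stands in for a quotient, so \<open>L\<close> and
  \<open>M\<close> may live in different types.\<close>

definition lie_subquotient ::
  "('k::field, 'w::ab_group_add) lie_alg \<Rightarrow> ('k, 'v::ab_group_add) lie_alg \<Rightarrow> bool"
  where "lie_subquotient L M \<longleftrightarrow>
    (\<exists>S g. lie_subalgebra M S \<and> lie_hom (lie_restrict M S) L g \<and> g ` S = lie_carrier L)"

lemma lie_ideal_imp_subalgebra: "lie_ideal M I \<Longrightarrow> lie_subalgebra M I"
  unfolding lie_ideal_def lie_subalgebra_def by blast

lemma lie_hom_zero: "lie_hom M N f \<Longrightarrow> 0 \<in> lie_carrier M \<Longrightarrow> f 0 = 0"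
  unfolding lie_hom_def by (metis add.right_neutral add_left_cancel)

lemma lie_hom_minus:
  assumes "lie_hom M N f" "x \<in> lie_carrier M" "y \<in> lie_carrier M" "x - y \<in> lie_carrier M"
  shows "f (x - y) = f x - f y"
proof -
  have "f (x - y + y) = f (x - y) + f y"
    using assms unfolding lie_hom_def by blast
  then show ?thesis by simp
qed

lemma lie_hom_restrict:
  "lie_hom M N f \<Longrightarrow> S \<subseteq> lie_carrier M \<Longrightarrow> lie_hom (lie_restrict M S) N f"
  unfolding lie_hom_def by (auto simp: subset_iff)

lemma lie_hom_comp:
  "lie_hom M N f \<Longrightarrow> lie_hom N Q g \<Longrightarrow> lie_hom M Q (g \<circ> f)"
  unfolding lie_hom_def by (auto simp: image_subset_iff)

lemma lie_hom_id_restrict: "lie_hom (lie_restrict M S) (lie_restrict M S) (\<lambda>x. x)"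
  unfolding lie_hom_def by auto

context lie_algebra
begin

lemma subalgebraD:
  assumes "lie_subalgebra M S"
  shows "subspace S" "S \<subseteq> lie_carrier M" "0 \<in> S" "x \<in> S \<Longrightarrow> y \<in> S \<Longrightarrow> x + y \<in> S"
    "x \<in> S \<Longrightarrow> lie_scale M c x \<in> S" "x \<in> S \<Longrightarrow> y \<in> S \<Longrightarrow> x - y \<in> S"
    "x \<in> S \<Longrightarrow> y \<in> S \<Longrightarrow> lie_bracket M x y \<in> S"
  using assms unfolding lie_subalgebra_def
  by (auto simp: subspace_0 subspace_add subspace_scale subspace_diff)

lemma lie_algebra_restrict: "lie_subalgebra M S \<Longrightarrow> lie_algebra (lie_restrict M S)"
  by unfold_locales
     (use subalgebraD[of S] in \<open>auto simp: scale_right_distrib scale_left_distrib subset_iff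
        bracket_add_left bracket_add_right bracket_scale_left bracket_scale_right bracket_self jacobi\<close>)

lemma subalgebra_carrier: "lie_subalgebra M (lie_carrier M)"
  using subspace_carrier unfolding lie_subalgebra_def by simp

lemma subalgebra_vimage:
  assumes "lie_hom M N f" "lie_algebra N" "lie_subalgebra N T"
  shows "lie_subalgebra M {x \<in> lie_carrier M. f x \<in> T}"
proof -
  interpret N: lie_algebra N by fact
  have "f 0 = 0" using lie_hom_zero[OF assms(1)] by simp
  then show ?thesis
    using assms(1) N.subalgebraD[OF assms(3)]
    unfolding lie_subalgebra_def subspace_def lie_hom_def by auto
qed

lemma subalgebra_image:
  assumes "lie_hom M N f" "lie_algebra N" "lie_subalgebra M S"
  shows "lie_subalgebra N (f ` S)"
proof -
  interpret N: lie_algebra N by fact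
  note SD = subalgebraD[OF assms(3)]
  have f: "f (x + y) = f x + f y" "f (lie_scale M c x) = lie_scale N c (f x)"
    "f (lie_bracket M x y) = lie_bracket N (f x) (f y)" "f x \<in> lie_carrier N" if "x \<in> S" "y \<in> S" for x y c
    using assms(1) that SD(2) unfolding lie_hom_def by (auto simp: subset_iff)
  show ?thesis
    unfolding lie_subalgebra_def N.subspace_def
  proof (intro conjI ballI allI)
    have "f 0 = 0" using lie_hom_zero[OF assms(1)] by simp
    then show "0 \<in> f ` S" using SD by (metis imageI)
    show "f ` S \<subseteq> lie_carrier N" using f(4) by auto
    show "a + b \<in> f ` S" if "a \<in> f ` S" "b \<in> f ` S" for a b
      using that SD(4) by (auto simp flip: f(1))
    show "lie_bracket N a b \<in> f ` S" if "a \<in> f ` S" "b \<in> f ` S" for a b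
      using that SD(7) by (auto simp flip: f(3))
    show "lie_scale N c a \<in> f ` S" if "a \<in> f ` S" for a c
      using that SD(5) by (auto simp flip: f(2))
  qed
qed

lemma subalgebra_Int:
  "lie_subalgebra M S \<Longrightarrow> lie_subalgebra M T \<Longrightarrow> lie_subalgebra M (S \<inter> T)"
  unfolding lie_subalgebra_def by (auto intro: subspace_inter)

lemma subalgebra_kernel:
  assumes "lie_hom M N f" "lie_algebra N"
  shows "lie_subalgebra M (lie_kernel M f)"
proof -
  interpret N: lie_algebra N by fact
  have "lie_subalgebra N {0}"
    unfolding lie_subalgebra_def by (simp add: N.subspace_single_0)
  from subalgebra_vimage[OF assms this] show ?thesis
    by (simp add: lie_kernel_def)
qed

end

lemma lie_subalgebra_restrict_iff:
  "lie_subalgebra (lie_restrict M S) T \<longleftrightarrow>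
    module.subspace (lie_scale M) T \<and> T \<subseteq> S \<and> (\<forall>x\<in>T. \<forall>y\<in>T. lie_bracket M x y \<in> T)"
  by (simp add: lie_subalgebra_def)

lemma lie_subquotient_mono:
  assumes "lie_subquotient L (lie_restrict M S)" "S \<subseteq> lie_carrier M"
  shows "lie_subquotient L M"
  using assms unfolding lie_subquotient_def lie_subalgebra_restrict_iff lie_subalgebra_def
  by fastforce

text \<open>Transitivity of subquotients: a subalgebra \<open>T\<close> of the image pulls back to
  its preimage in \<open>S\<close>, and the two homomorphisms compose.\<close>

lemma lie_subquotient_restrict_image:
  assumes "lie_algebra M" "lie_algebra L" "lie_subalgebra M S" "lie_hom (lie_restrict M S) L g"
    "lie_subquotient N (lie_restrict L (g ` S))"
  shows "lie_subquotient N (lie_restrict M S)"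
proof -
  interpret M: lie_algebra M by fact
  interpret R: lie_algebra "lie_restrict M S" by (rule M.lie_algebra_restrict) fact
  obtain T h where T: "lie_subalgebra L T" "T \<subseteq> g ` S" "lie_hom (lie_restrict L T) N h"
    "h ` T = lie_carrier N"
  proof -
    from assms(5) obtain T h where *: "lie_subalgebra (lie_restrict L (g ` S)) T"
      "lie_hom (lie_restrict (lie_restrict L (g ` S)) T) N h" "h ` T = lie_carrier N"
      unfolding lie_subquotient_def by blast
    moreover have "g ` S \<subseteq> lie_carrier L" using assms(4) by (simp add: lie_hom_def)
    ultimately show ?thesis
      by (intro that[of T h]) (auto simp: lie_subalgebra_def)
  qed
  define U where "U = {x \<in> S. g x \<in> T}"
  have "lie_subalgebra (lie_restrict M S) U"
    using R.subalgebra_vimage[OF assms(4,2) T(1)] by (simp add: U_def)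
  moreover have "lie_hom (lie_restrict M U) (lie_restrict L T) g"
    using assms(4) unfolding lie_hom_def U_def by auto
  moreover have "g ` U = T" using T(2) unfolding U_def by auto
  ultimately show ?thesis
    using lie_hom_comp[OF _ T(3)] T(4) unfolding lie_subquotient_def
    by (intro exI[of _ U] exI[of _ "h \<circ> g"]) (auto simp: image_comp[symmetric])
qed

lemma lie_algebra_lie_closure: "lie_closure P M \<Longrightarrow> lie_algebra M"
  by (induction rule: lie_closure.induct) (auto intro: lie_algebra.lie_algebra_restrict)

section \<open>Obstruction to being elementary\<close>

text \<open>A basis of the subalgebra is finite, being independent in a finite-dimensional space,
  and its image spans \<open>L\<close>.\<close>

lemma lie_finite_dim_image:
  fixes M :: "('k::field, 'v::ab_group_add) lie_alg" and L :: "('k, 'w::ab_group_add) lie_alg"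
  assumes "lie_algebra M" "lie_algebra L" "lie_finite_dim M" "lie_subalgebra M S"
    "lie_hom (lie_restrict M S) L g" "g ` S = lie_carrier L"
  shows "lie_finite_dim L"
proof -
  interpret M: lie_algebra M by fact
  interpret L: lie_algebra L by fact
  interpret S: lie_algebra "lie_restrict M S" by (rule M.lie_algebra_restrict) fact
  obtain B where B: "finite B" "lie_carrier M = M.span B"
    using assms(3) unfolding lie_finite_dim_def by blast
  obtain A where A: "A \<subseteq> S" "M.independent A" "S = M.span A"
    using M.maximal_independent_subset[of S] M.span_subspace M.subalgebraD(1)[OF assms(4)] by metis
  have "finite A"
    using M.independent_span_bound[OF B(1) A(2)] A(1) M.subalgebraD(2)[OF assms(4)] B(2) by auto
  moreover have "lie_carrier L = L.span (g ` A)"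
  proof
    have "x \<in> S \<and> g x \<in> L.span (g ` A)" if "x \<in> M.span A" for x
      using that
    proof (induction rule: M.span_induct_alt)
      case base
      then show ?case using lie_hom_zero[OF assms(5)] S.carrier_zero L.span_zero by simp
    next
      case (step c x y)
      then have *: "x \<in> S" "lie_scale M c x \<in> S" "y \<in> S"
        using A S.carrier_scale[of x c] by auto
      then have "g (lie_scale M c x + y) = lie_scale L c (g x) + g y"
        using assms(5) unfolding lie_hom_def by simp
      then show ?case
        using step * L.span_add L.span_scale L.span_base S.carrier_add[of "lie_scale M c x" y]
        by (simp add: L.span_base)
    qed
    then show "lie_carrier L \<subseteq> L.span (g ` A)"
      using A(3) by (auto simp flip: assms(6))
    show "L.span (g ` A) \<subseteq> lie_carrier L"
      using A(1) assms(6) L.subspace_carrier by (intro L.span_minimal) auto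
  qed
  ultimately show ?thesis unfolding lie_finite_dim_def by blast
qed

text \<open>
  A subalgebra of an extension mapping onto \<open>L\<close> either factors through the quotient, or its
  intersection with the kernel maps onto a nonzero ideal of \<open>L\<close>.
\<close>

lemma lie_subquotient_extension:
  fixes M :: "('k::field, 'v::ab_group_add) lie_alg" and L :: "('k, 'w::ab_group_add) lie_alg"
  assumes "lie_algebra M" "lie_algebra Q" "lie_algebra L" "lie_hom M Q f"
    "lie_subquotient L M"
    and rich: "\<And>I. lie_ideal L I \<Longrightarrow> I \<noteq> {0} \<Longrightarrow> lie_subquotient L (lie_restrict L I)"
  shows "lie_subquotient L (lie_restrict M (lie_kernel M f)) \<or> lie_subquotient L Q"
proof -
  interpret M: lie_algebra M by fact
  interpret L: lie_algebra L by fact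
  interpret Q: lie_algebra Q by fact
  obtain S g where S: "lie_subalgebra M S" and g: "lie_hom (lie_restrict M S) L g"
    and onto: "g ` S = lie_carrier L"
    using assms(5) unfolding lie_subquotient_def by blast
  note SD = M.subalgebraD[OF S]
  interpret R: lie_algebra "lie_restrict M S" by (rule M.lie_algebra_restrict) fact
  define K where "K = S \<inter> lie_kernel M f"
  have K: "lie_subalgebra M K"
    unfolding K_def using M.subalgebra_Int[OF S M.subalgebra_kernel[OF assms(4,2)]] .
  have gK: "lie_hom (lie_restrict M K) L g"
    using lie_hom_restrict[OF g, of K] by (simp add: K_def)
  have g': "g (x + y) = g x + g y" "g (lie_scale M c x) = lie_scale L c (g x)"
    "g (lie_bracket M x y) = lie_bracket L (g x) (g y)" if "x \<in> S" "y \<in> S" for x y c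
    using g that unfolding lie_hom_def by auto
  have f': "f (x + y) = f x + f y" "f (lie_scale M c x) = lie_scale Q c (f x)"
    "f (lie_bracket M x y) = lie_bracket Q (f x) (f y)" "f x \<in> lie_carrier Q" if "x \<in> S" "y \<in> S" for x y c
    using assms(4) that SD(2) unfolding lie_hom_def by (auto simp: subset_iff)
  show ?thesis
  proof (cases "g ` K = {0}")
    case False
    \<comment> \<open>\<open>K\<close> absorbs brackets with \<open>S\<close>, and \<open>g\<close>
      maps \<open>S\<close> onto all of \<open>L\<close>.\<close>
    have "lie_ideal L (g ` K)"
      unfolding lie_ideal_def
    proof (intro conjI ballI)
      show "L.subspace (g ` K)"
        using R.subalgebra_image[OF g assms(3), of K] K
        by (simp add: lie_subalgebra_def K_def)
      show "g ` K \<subseteq> lie_carrier L" using onto K_def by auto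
      fix a b assume "a \<in> lie_carrier L" "b \<in> g ` K"
      then obtain x y where xy: "x \<in> S" "a = g x" "y \<in> S" "y \<in> lie_carrier M" "f y = 0" "b = g y"
        using onto unfolding K_def lie_kernel_def by blast
      have "lie_bracket M x y \<in> K"
        using xy SD f'[of x y] f'(4)[of x x] unfolding K_def lie_kernel_def by auto
      then show "lie_bracket L a b \<in> g ` K"
        using xy g'(3)[of x y] by (metis imageI)
    qed
    from lie_subquotient_restrict_image[OF assms(1,3) K gK rich[OF this False]]
    have "lie_subquotient L (lie_restrict M K)" .
    then have "lie_subquotient L (lie_restrict (lie_restrict M (lie_kernel M f)) K)" by simp
    from lie_subquotient_mono[OF this] show ?thesis by (simp add: K_def)
  next
    case True
    \<comment> \<open>Elements of \<open>S\<close> with equal values of \<open>f\<close> differ by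
      an element of \<open>K\<close>, where \<open>g\<close> vanishes; so \<open>g\<close> descends
      to a map \<open>h\<close> on the image of \<open>S\<close> in \<open>Q\<close>.\<close>
    have wd: "g x = g y" if "x \<in> S" "y \<in> S" "f x = f y" for x y
    proof -
      have "f (x - y) = 0"
        using lie_hom_minus[OF assms(4), of x y] that SD by auto
      then have "x - y \<in> K" using that SD unfolding K_def lie_kernel_def by auto
      then have "g (x - y) = 0" using True by auto
      then show ?thesis using lie_hom_minus[OF g, of x y] that SD by auto
    qed
    define h where "h y = g (SOME x. x \<in> S \<and> f x = y)" for y
    have h: "h (f x) = g x" if "x \<in> S" for x
      unfolding h_def using someI[of "\<lambda>z. z \<in> S \<and> f z = f x" x] that wd by blast
    have T: "lie_subalgebra Q (f ` S)"
      using M.subalgebra_image[OF assms(4,2) S] .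
    have "lie_hom (lie_restrict Q (f ` S)) L h"
      unfolding lie_hom_def
    proof (simp, intro conjI ballI allI)
      show "h ` f ` S \<subseteq> lie_carrier L" using onto h by auto
      show "h (f x + f y) = h (f x) + h (f y)" if "x \<in> S" "y \<in> S" for x y
        using that SD(4)[of x y] h by (simp add: g' flip: f'(1))
      show "h (lie_scale Q c (f x)) = lie_scale L c (h (f x))" if "x \<in> S" for x c
        using that SD(5)[of x c] h[of x] h[of "lie_scale M c x"] g'(2)[OF that that] f'(2)[OF that that] by metis
      show "h (lie_bracket Q (f x) (f y)) = lie_bracket L (h (f x)) (h (f y))" if "x \<in> S" "y \<in> S" for x y
        using that SD(7)[of x y] h by (simp add: g' flip: f'(3))
    qed
    moreover have "h ` f ` S = lie_carrier L" using h onto by (auto simp: image_image)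
    ultimately show ?thesis using T unfolding lie_subquotient_def by blast
  qed
qed

text \<open>Induction over the class. Finite dimension and commutativity pass to subquotients, which
  settles the base case; \<open>rich\<close> settles extensions, finite generation settles directed
  unions, and subalgebras and quotients need only transitivity.\<close>

lemma not_in_EL_if_subquotient:
  fixes M :: "('k::field, 'v::ab_group_add) lie_alg" and L :: "('k, 'w::ab_group_add) lie_alg"
  assumes L: "lie_algebra L" and "\<not> lie_finite_dim L" and "\<not> lie_abelian L"
    and fg: "finite G" "G \<subseteq> lie_carrier L"
      "\<And>S. lie_subalgebra L S \<Longrightarrow> G \<subseteq> S \<Longrightarrow> S = lie_carrier L"
    and rich: "\<And>I. lie_ideal L I \<Longrightarrow> I \<noteq> {0} \<Longrightarrow> lie_subquotient L (lie_restrict L I)"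
    and sub: "lie_subquotient L M"
  shows "M \<notin> EL"
proof -
  interpret L: lie_algebra L by fact
  have "\<not> lie_subquotient L M" if "lie_closure (\<lambda>A. lie_finite_dim A \<or> lie_abelian A) M"
    using that
  proof (induction rule: lie_closure.induct)
    case (base M)
    show ?case
    proof
      assume "lie_subquotient L M"
      then obtain S g where S: "lie_subalgebra M S" "lie_hom (lie_restrict M S) L g" "g ` S = lie_carrier L"
        unfolding lie_subquotient_def by blast
      have "\<not> lie_finite_dim M"
        using lie_finite_dim_image[OF base(1) L _ S] assms(2) by blast
      moreover have "lie_abelian L" if "lie_abelian M"
        unfolding lie_abelian_def
      proof (intro ballI)
        fix x y assume "x \<in> lie_carrier L" "y \<in> lie_carrier L"
        then obtain a b where ab: "a \<in> S" "b \<in> S" "x = g a" "y = g b" using S(3) by blast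
        moreover have "lie_bracket M a b = 0"
          using that ab S(1) unfolding lie_abelian_def lie_subalgebra_def by blast
        moreover have "0 \<in> S"
          using lie_algebra.subalgebraD(3)[OF base(1) S(1)] .
        ultimately show "lie_bracket L x y = 0"
          using S(2) lie_hom_zero[OF S(2)] unfolding lie_hom_def by force
      qed
      ultimately show False using base assms(3) by blast
    qed
  next
    case (subalgebra M S)
    then show ?case using lie_subquotient_mono unfolding lie_subalgebra_def by blast
  next
    case (quotient M Q f)
    have M: "lie_algebra M" using quotient(1) by (rule lie_algebra_lie_closure)
    interpret M: lie_algebra M by fact
    have "lie_restrict M (lie_carrier M) = M" "lie_restrict Q (lie_carrier Q) = Q" by simp_all
    with lie_subquotient_restrict_image[OF M quotient(2) M.subalgebra_carrier, of f L] quotient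
    show ?case by (metis (no_types))
  next
    case (extension M Q f)
    then show ?case
      using lie_subquotient_extension[OF _ _ L, of M Q f] lie_algebra_lie_closure rich by blast
  next
    case (directed_union M \<S>)
    show ?case
    proof
      assume "lie_subquotient L M"
      then obtain S g where S: "lie_subalgebra M S" and g: "lie_hom (lie_restrict M S) L g"
        and onto: "g ` S = lie_carrier L"
        unfolding lie_subquotient_def by blast
      interpret M: lie_algebra M by (rule directed_union)
      \<comment> \<open>Preimages of finitely many elements fit into a single member of the directed
        family. For the generators \<open>G\<close>, that member already maps onto
        \<open>L\<close>.\<close>
      have "\<exists>T\<in>\<S>. A \<subseteq> g ` (S \<inter> T)" if "finite A" "A \<subseteq> lie_carrier L" for A
        using that
      proof (induction A rule: finite_induct)
        case empty
        then show ?case using directed_union(2) by auto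
      next
        case (insert a A)
        then obtain T where T: "T \<in> \<S>" "A \<subseteq> g ` (S \<inter> T)" by auto
        obtain x where x: "x \<in> S" "a = g x" using insert onto by blast
        then obtain U where U: "U \<in> \<S>" "x \<in> U"
          using M.subalgebraD(2)[OF S] directed_union(5) by auto
        from directed_union(4)[OF T(1) U(1)] obtain V where "V \<in> \<S>" "T \<subseteq> V" "U \<subseteq> V" by blast
        moreover have "A \<subseteq> g ` (S \<inter> V)" using T(2) \<open>T \<subseteq> V\<close> by blast
        ultimately show ?case using U x by (intro bexI[of _ V]) auto
      qed
      from this[OF fg(1,2)] obtain T where T: "T \<in> \<S>" "G \<subseteq> g ` (S \<inter> T)" by blast
      have ST: "lie_subalgebra M (S \<inter> T)"
        using M.subalgebra_Int S directed_union(3) T(1) by blast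
      have gST: "lie_hom (lie_restrict M (S \<inter> T)) L g"
        using lie_hom_restrict[OF g, of "S \<inter> T"] by simp
      interpret ST: lie_algebra "lie_restrict M (S \<inter> T)" by (rule M.lie_algebra_restrict) fact
      have "lie_subalgebra L (g ` (S \<inter> T))"
        using ST.subalgebra_image[OF gST L ST.subalgebra_carrier] by simp
      then have "g ` (S \<inter> T) = lie_carrier L" using fg(3) T(2) by blast
      then have "lie_subquotient L (lie_restrict (lie_restrict M T) (S \<inter> T))"
        using ST gST unfolding lie_subquotient_def
        by (intro exI[of _ "S \<inter> T"] exI[of _ g]) (simp add: lie_subalgebra_def)
      from lie_subquotient_mono[OF this] have "lie_subquotient L (lie_restrict M T)" by simp
      then show False using directed_union(7)[OF T(1)] by blast
    qed
  qed
  then show ?thesis using sub unfolding EL_def by blast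
qed

section \<open>The coefficients of the self-similarity map\<close>

lemma free_lie_induct [case_names gen zero add scale bracket]:
  fixes a :: "('k::field, 'g) free_lie"
  assumes "\<And>x. P (free_gen x)" "P 0" "\<And>a b. P a \<Longrightarrow> P b \<Longrightarrow> P (a + b)"
    "\<And>r a. P a \<Longrightarrow> P (free_scale r a)" "\<And>a b. P a \<Longrightarrow> P b \<Longrightarrow> P (free_bracket a b)"
  shows "P a"
proof -
  have "P (abs_free_lie t)" for t :: "('k, 'g) lie_term"
    by (induction t) (use assms in \<open>simp_all flip: free_gen.abs_eq zero_free_lie.abs_eq
      plus_free_lie.abs_eq free_scale.abs_eq free_bracket.abs_eq\<close>)
  then show ?thesis using free_lie_abs_cases[of a] by auto
qed

lemma xcoeff_xvar_power':
  "xcoeff ((xvar :: 'k::field trunc_poly) ^ n) j = (if n = j \<and> j < CHAR('k) then 1 else 0)"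
proof (cases "n < CHAR('k)")
  case False
  then have "monom 1 n mod monom 1 CHAR('k) = (0 :: 'k poly)"
    by (metis dvd_eq_mod_eq_0 le_add_diff_inverse linorder_not_less mult_monom mult_1 dvd_triv_left)
  with False show ?thesis
    by (auto simp: xvar_power xcoeff.abs_eq)
qed (auto simp: xcoeff_xvar_power)

lemma xcoeff_partial_x_xvar_power:
  assumes "i < CHAR('k)"
  shows "xcoeff (partial_x ((xvar :: 'k::field trunc_poly) ^ i)) j = (if i = Suc j then of_nat i else 0)"
proof -
  have "xcoeff (partial_x ((xvar :: 'k::field trunc_poly) ^ i)) j =
      coeff (monom (of_nat i) (i - 1) mod monom 1 CHAR('k)) j"
    by (simp add: xvar_power partial_x.abs_eq xcoeff.abs_eq pderiv_monom)
  also have "monom (of_nat i :: 'k) (i - 1) mod monom 1 CHAR('k) = monom (of_nat i) (i - 1)"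
    using assms by (cases "of_nat i = (0 :: 'k)") (auto simp: mod_poly_less degree_monom_eq)
  finally show ?thesis by (cases i) auto
qed

context lie_algebra
begin

text \<open>A Cauchy product: only exponents with \<open>i + j = l\<close> contribute to
  \<open>x^l\<close>.\<close>

lemma tensor_bracket_apply:
  assumes "lie_carrier M = UNIV" "l < CHAR('k)"
  shows "tensor_bracket M m n l = (\<Sum>j\<le>l. lie_bracket M (m j) (n (l - j)))"
proof -
  have "tensor_bracket M m n l =
      (\<Sum>i<CHAR('k). \<Sum>j<CHAR('k). if j = l - i \<and> i \<le> l then lie_bracket M (m i) (n j) else 0)"
    unfolding tensor_bracket_def sum_fun_apply tensor_def power_add[symmetric]
    by (intro sum.cong refl) (use assms in \<open>auto simp: xcoeff_xvar_power'\<close>)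
  also have "\<dots> = (\<Sum>i<CHAR('k). if i \<le> l then lie_bracket M (m i) (n (l - i)) else 0)"
    using assms(2) by (intro sum.cong refl) auto
  also have "\<dots> = (\<Sum>j\<le>l. lie_bracket M (m j) (n (l - j)))"
    using assms(2) by (intro sum.mono_neutral_cong_right) auto
  finally show ?thesis .
qed

text \<open>The only power whose derivative involves \<open>x^l\<close> is \<open>x^(l+1)\<close>.
  The vanishing assumption covers \<open>l = CHAR('k) - 1\<close>.\<close>

lemma tensor_act_partial_x_apply:
  fixes m :: "nat \<Rightarrow> 'v"
  assumes "l < CHAR('k)" "\<And>i. CHAR('k) \<le> i \<Longrightarrow> m i = 0"
  shows "tensor_act M partial_x m l = lie_scale M (of_nat (Suc l)) (m (Suc l))"
proof -
  have "tensor_act M partial_x m l =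
      (\<Sum>i<CHAR('k). if i = Suc l then lie_scale M (of_nat i) (m i) else 0)"
    unfolding tensor_act_def sum_fun_apply tensor_def
    by (intro sum.cong refl) (auto simp: xcoeff_partial_x_xvar_power)
  then show ?thesis using assms(2)[of "Suc l"] assms(1) by auto
qed

end

text \<open>The derivation part of \<open>psz_psi a\<close> turns out to be a multiple of
  \<open>partial_x\<close>; as \<open>partial_x xvar = 1\<close>, its value at \<open>xvar\<close>
  reveals the scalar.\<close>

definition psz_psi_der :: "('k::field, psz_gen) free_lie \<Rightarrow> 'k"
  where "psz_psi_der a = xcoeff (snd (psz_psi a) xvar) 0"

text \<open>Multiples of \<open>partial_x\<close> include the values on both generators and commute
  with each other, so brackets have derivation part zero.\<close>

lemma snd_psz_psi:
  fixes a :: "('k::field, psz_gen) free_lie"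
  assumes "CHAR('k) > 0"
  shows "snd (psz_psi a) = (\<lambda>q. xscale (psz_psi_der a) (partial_x q))"
proof -
  interpret X: vector_space "xscale :: 'k \<Rightarrow> _" by (rule vector_space_xscale)
  have "\<exists>r. snd (psz_psi a) = (\<lambda>q. xscale r (partial_x q))"
  proof (induction a rule: free_lie_induct)
    case (gen x)
    then show ?case
      by (cases x) (auto simp: psz_psi fun_eq_iff intro: exI[of _ 0] exI[of _ 1])
  next
    case zero
    then show ?case by (auto simp: psz_psi_0 fun_eq_iff intro: exI[of _ 0])
  next
    case (add a b)
    then obtain r r' where "snd (psz_psi a) = (\<lambda>q. xscale r (partial_x q))"
      "snd (psz_psi b) = (\<lambda>q. xscale r' (partial_x q))" by blast
    then show ?case
      by (intro exI[of _ "r + r'"]) (simp add: psz_psi_add fun_eq_iff X.scale_left_distrib)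
  next
    case (scale r a)
    then obtain r' where "snd (psz_psi a) = (\<lambda>q. xscale r' (partial_x q))" by blast
    then show ?case
      by (cases "psz_psi a", intro exI[of _ "r * r'"])
         (simp add: psz_psi_scale fun_eq_iff semidirect_simps)
  next
    case (bracket a b)
    then obtain r r' where "snd (psz_psi a) = (\<lambda>q. xscale r (partial_x q))"
      "snd (psz_psi b) = (\<lambda>q. xscale r' (partial_x q))" by blast
    then show ?case
      by (cases "psz_psi a"; cases "psz_psi b", intro exI[of _ 0])
         (simp add: psz_psi_bracket fun_eq_iff semidirect_simps DerD(2)[OF partial_x_Der] mult.commute)
  qed
  then obtain r where r: "snd (psz_psi a) = (\<lambda>q. xscale r (partial_x q))" by blast
  have "psz_psi_der a = r"
    using xcoeff_xvar_power'[of 0 0, where ?'k = 'k] assms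
    by (simp add: psz_psi_der_def r partial_x_xvar xcoeff_xscale)
  with r show ?thesis by simp
qed

lemma psz_psi_der_eq_0_iff:
  fixes a :: "('k::field, psz_gen) free_lie"
  assumes "CHAR('k) > 0"
  shows "psz_psi_der a = 0 \<longleftrightarrow> snd (psz_psi a) = 0"
proof
  interpret X: vector_space "xscale :: 'k \<Rightarrow> _" by (rule vector_space_xscale)
  show "snd (psz_psi a) = 0" if "psz_psi_der a = 0"
    using that by (simp add: snd_psz_psi[OF assms] fun_eq_iff)
qed (simp add: psz_psi_der_def)

lemma psz_psi_beyond:
  fixes a :: "('k::field, psz_gen) free_lie"
  shows "CHAR('k) \<le> i \<Longrightarrow> fst (psz_psi a) i = 0"
  using psz_psi_closed[of a] by (auto simp: semidirect_def tensor_set_def)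

lemma
  fixes a b :: "('k::field, psz_gen) free_lie"
  shows psz_psi_der_add: "psz_psi_der (a + b) = psz_psi_der a + psz_psi_der b"
    and psz_psi_der_scale: "psz_psi_der (free_scale r a) = r * psz_psi_der a"
proof -
  show "psz_psi_der (a + b) = psz_psi_der a + psz_psi_der b"
    by (simp add: psz_psi_der_def psz_psi_add xcoeff_add)
  show "psz_psi_der (free_scale r a) = r * psz_psi_der a"
    unfolding psz_psi_der_def psz_psi_scale
    by (cases "psz_psi a") (simp add: semidirect_simps xcoeff_xscale)
qed

text \<open>The semidirect bracket in coordinates: the Cauchy product comes from the tensor part,
  and each derivation part differentiates the other argument, which raises the index by one.\<close>

lemma
  fixes a b :: "('k::field, psz_gen) free_lie"
  assumes "CHAR('k) > 0"
  shows psz_psi_der_bracket: "psz_psi_der (free_bracket a b) = 0"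
    and psz_psi_coeff_bracket: "i < CHAR('k) \<Longrightarrow> fst (psz_psi (free_bracket a b)) i =
      (\<Sum>j\<le>i. free_bracket (fst (psz_psi a) j) (fst (psz_psi b) (i - j)))
      + free_scale (psz_psi_der a * of_nat (Suc i)) (fst (psz_psi b) (Suc i))
      - free_scale (psz_psi_der b * of_nat (Suc i)) (fst (psz_psi a) (Suc i))"
proof -
  interpret F: lie_algebra "free_lie_alg :: ('k, ('k, psz_gen) free_lie) lie_alg"
    by (rule lie_algebra_free_lie_alg)
  interpret X: vector_space "xscale :: 'k \<Rightarrow> _" by (rule vector_space_xscale)
  obtain m n where mn: "psz_psi a = (m, \<lambda>q. xscale (psz_psi_der a) (partial_x q))"
      "psz_psi b = (n, \<lambda>q. xscale (psz_psi_der b) (partial_x q))"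
    using snd_psz_psi[OF assms] by (metis prod.collapse)
  show "psz_psi_der (free_bracket a b) = 0"
    unfolding psz_psi_der_def[of "free_bracket a b"] psz_psi_bracket mn
    by (simp add: semidirect_simps DerD(2)[OF partial_x_Der] mult.commute)
  have "\<And>i. CHAR('k) \<le> i \<Longrightarrow> m i = 0" "\<And>i. CHAR('k) \<le> i \<Longrightarrow> n i = 0"
    using psz_psi_beyond[of _ a] psz_psi_beyond[of _ b] mn by auto
  then show "i < CHAR('k) \<Longrightarrow> fst (psz_psi (free_bracket a b)) i =
      (\<Sum>j\<le>i. free_bracket (fst (psz_psi a) j) (fst (psz_psi b) (i - j)))
      + free_scale (psz_psi_der a * of_nat (Suc i)) (fst (psz_psi b) (Suc i))
      - free_scale (psz_psi_der b * of_nat (Suc i)) (fst (psz_psi a) (Suc i))"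
    unfolding psz_psi_bracket mn
    by (simp del: of_nat_Suc add: semidirect_simps F.tensor_act_scale_der F.tensor_bracket_apply
      F.tensor_act_partial_x_apply
      F.scale_scale[simplified])
qed

lemma mem_psz_idealD:
  fixes a :: "('k::field, psz_gen) free_lie"
  assumes "a \<in> psz_ideal"
  shows "psz_psi_der a = 0" "fst (psz_psi a) i \<in> psz_ideal"
proof -
  obtain k where "a \<in> psz_N k" using assms by (auto simp: psz_ideal_def)
  \<comment> \<open>Moving up one stage makes the definition as a preimage available even for
    \<open>k = 0\<close>.\<close>
  then have *: "a \<in> psz_N (Suc k)" using psz_N_mono[of k "Suc k"] by auto
  then have "fst (psz_psi a) i \<in> psz_N k"
    using psz_N_ideal(1) by (cases "i < CHAR('k)") (auto simp: tensor_set_def mem_Times_iff)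
  then show "fst (psz_psi a) i \<in> psz_ideal" unfolding psz_ideal_def by blast
  show "psz_psi_der a = 0" using * by (auto simp: psz_psi_der_def mem_Times_iff)
qed

text \<open>Injectivity of the induced map on the quotient. Only finitely many coefficients can be
  nonzero, so one stage \<open>l\<close> of the increasing chain contains them all.\<close>

lemma mem_psz_idealI:
  fixes a :: "('k::field, psz_gen) free_lie"
  assumes "CHAR('k) > 0" "psz_psi_der a = 0" "\<And>i. fst (psz_psi a) i \<in> psz_ideal"
  shows "a \<in> psz_ideal"
proof -
  have "\<forall>i. \<exists>k. fst (psz_psi a) i \<in> psz_N k" using assms(3) by (simp add: psz_ideal_def)
  from choice[OF this] obtain k where k: "\<And>i. fst (psz_psi a) i \<in> psz_N (k i)" by blast
  define l where "l = Max (k ` {..<CHAR('k)})"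
  have "fst (psz_psi a) i \<in> psz_N l" if "i < CHAR('k)" for i
    using k[of i] psz_N_mono[of "k i" l] that by (auto simp: l_def)
  then have "a \<in> psz_N (Suc l)"
    using psz_psi_beyond[of _ a] assms(2)[unfolded psz_psi_der_eq_0_iff[OF assms(1)]]
    by (simp add: tensor_set_def mem_Times_iff)
  then show "a \<in> psz_ideal" unfolding psz_ideal_def by blast
qed

lift_definition psz_der :: "'k::field psz \<Rightarrow> 'k" is psz_psi_der
proof -
  fix a b :: "('k, psz_gen) free_lie"
  assume "a - b \<in> psz_ideal"
  then show "psz_psi_der a = psz_psi_der b"
    using psz_psi_der_add[of "a - b" b] mem_psz_idealD(1) by simp
qed

lift_definition psz_coeff :: "nat \<Rightarrow> 'k::field psz \<Rightarrow> 'k psz" is "\<lambda>i a. fst (psz_psi a) i"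
proof -
  fix i and a b :: "('k, psz_gen) free_lie"
  assume *: "a - b \<in> psz_ideal"
  have "fst (psz_psi a) i - fst (psz_psi b) i = fst (psz_psi (a - b)) i"
    using psz_psi_add[of "a - b" b] by simp
  with mem_psz_idealD(2)[OF *] show "fst (psz_psi a) i - fst (psz_psi b) i \<in> psz_ideal" by simp
qed

lift_definition psz_d :: "'k::field psz" is "free_gen Dgen" .
lift_definition psz_v :: "'k::field psz" is "free_gen Vgen" .

lemma psz_abs_cases: "\<exists>b. a = abs_psz b"
  by (metis Quotient3_abs_rep Quotient3_psz)

lemma psz_alg_simps [simp]:
  "lie_scale psz_alg = psz_scale" "lie_carrier psz_alg = UNIV" "lie_bracket psz_alg = psz_bracket"
  by (simp_all add: psz_alg_def)

section \<open>Ideals of the Petrogradsky--Shestakov--Zelmanov algebra\<close>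

text \<open>The self-similarity map in coordinates: \<open>c\<close> is the coefficient of
  \<open>partial_x\<close> and \<open>\<phi> i\<close> that of \<open>x^i\<close>. The arguments
  about ideals and growth use only these axioms, without reference to the free Lie algebra.\<close>

locale psz_structure = lie_algebra M
  for M :: "('k::field, 'v::ab_group_add) lie_alg" +
  fixes d v :: 'v and c :: "'v \<Rightarrow> 'k" and \<phi> :: "nat \<Rightarrow> 'v \<Rightarrow> 'v"
  assumes carrier [simp]: "lie_carrier M = UNIV"
    and prime_p: "prime CHAR('k)"
    and c_add: "c (a + b) = c a + c b"
    and c_scale: "c (lie_scale M r a) = r * c a"
    and c_bracket [simp]: "c (lie_bracket M a b) = 0"
    and \<phi>_add: "\<phi> i (a + b) = \<phi> i a + \<phi> i b"
    and \<phi>_scale: "\<phi> i (lie_scale M r a) = lie_scale M r (\<phi> i a)"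
    and \<phi>_beyond: "CHAR('k) \<le> i \<Longrightarrow> \<phi> i a = 0"
    and \<phi>_bracket: "i < CHAR('k) \<Longrightarrow> \<phi> i (lie_bracket M a b) =
      (\<Sum>j\<le>i. lie_bracket M (\<phi> j a) (\<phi> (i - j) b))
      + lie_scale M (c a * of_nat (Suc i)) (\<phi> (Suc i) b)
      - lie_scale M (c b * of_nat (Suc i)) (\<phi> (Suc i) a)"
    and injective: "c a = 0 \<Longrightarrow> (\<And>i. \<phi> i a = 0) \<Longrightarrow> a = 0"
    and c_d [simp]: "c d = 1" and \<phi>_d [simp]: "\<phi> i d = 0"
    and c_v [simp]: "c v = 0"
    and \<phi>_v: "\<phi> i v = (if i = 0 then d else if i = CHAR('k) - 1 then v else 0)"
    and generated: "lie_subalgebra M S \<Longrightarrow> d \<in> S \<Longrightarrow> v \<in> S \<Longrightarrow> S = UNIV"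
begin

abbreviation br :: "'v \<Rightarrow> 'v \<Rightarrow> 'v"
  where "br \<equiv> lie_bracket M"

lemma p_ge_2: "2 \<le> CHAR('k)"
  using prime_p by (rule prime_ge_2_nat)

lemma c_zero [simp]: "c 0 = 0"
  using c_scale[of 0 0] by simp

lemma \<phi>_zero [simp]: "\<phi> i 0 = 0"
  using \<phi>_add[of i 0 0] by simp

lemma \<phi>_0_v [simp]: "\<phi> 0 v = d"
  by (simp add: \<phi>_v)

lemma \<phi>_p_minus_1_v [simp]: "\<phi> (CHAR('k) - Suc 0) v = v"
  using p_ge_2 by (simp add: \<phi>_v)

text \<open>This Pochhammer symbol is \<open>n!\<close>, whose factors are positive and below the
  characteristic.\<close>

lemma pochhammer_1_neq_0: "n < CHAR('k) \<Longrightarrow> pochhammer 1 n \<noteq> (0 :: 'k)"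
proof (induction n)
  case (Suc n)
  then have "of_nat (Suc n) \<noteq> (0 :: 'k)"
    unfolding of_nat_eq_0_iff_char_dvd by (auto dest: dvd_imp_le)
  with Suc show ?case by (simp add: pochhammer_Suc)
qed simp

lemma \<phi>_br_d: "\<phi> i (br d a) = lie_scale M (of_nat (Suc i)) (\<phi> (Suc i) a)"
proof (cases "i < CHAR('k)")
  case True
  then show ?thesis by (simp add: \<phi>_bracket)
qed (simp add: \<phi>_beyond)

text \<open>As \<open>d\<close> is sent to \<open>partial_x\<close>, bracketing with
  \<open>d\<close> differentiates; repetition moves coefficient \<open>i + n\<close> to position
  \<open>i\<close>, up to a scalar.\<close>

lemma \<phi>_ad_d_power:
  "\<phi> i ((br d ^^ n) a) = lie_scale M (pochhammer (of_nat (Suc i)) n) (\<phi> (i + n) a)"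
proof (induction n arbitrary: i)
  case (Suc n)
  then show ?case
    by (simp add: \<phi>_br_d pochhammer_rec add.commute)
qed simp

lemma \<phi>_0_ad_d_power:
  "\<phi> 0 ((br d ^^ n) a) = lie_scale M (pochhammer 1 n) (\<phi> n a)"
  using \<phi>_ad_d_power[of 0 n a] by simp

section \<open>Evaluation at \<open>x = 0\<close> on the kernel of \<open>c\<close>\<close>

definition stab :: "'v set" where "stab = {a. c a = 0}"

lemma subalgebra_stab: "lie_subalgebra M stab"
  by (simp add: lie_subalgebra_def subspace_def stab_def c_add c_scale)

lemma \<phi>_0_bracket: "a \<in> stab \<Longrightarrow> b \<in> stab \<Longrightarrow> \<phi> 0 (br a b) = br (\<phi> 0 a) (\<phi> 0 b)"
  using p_ge_2 by (simp add: stab_def \<phi>_bracket)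

lemma hom_\<phi>_0: "S \<subseteq> stab \<Longrightarrow> lie_hom (lie_restrict M S) M (\<phi> 0)"
  unfolding lie_hom_def using \<phi>_0_bracket by (auto simp: \<phi>_add \<phi>_scale subset_iff)

lemma lie_idealD:
  assumes "lie_ideal M I"
  shows "subspace I" "a \<in> I \<Longrightarrow> br b a \<in> I" "a \<in> I \<Longrightarrow> br a b \<in> I"
    "a \<in> I \<Longrightarrow> lie_scale M r a \<in> I" "a \<in> I \<Longrightarrow> (br b ^^ n) a \<in> I"
proof -
  show "subspace I" using assms by (simp add: lie_ideal_def)
  show *: "br b a \<in> I" if "a \<in> I" for a b
    using assms that by (simp add: lie_ideal_def)
  show "lie_scale M r a \<in> I" if "a \<in> I"
    using subspace_scale \<open>subspace I\<close> that by blast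
  show "br a b \<in> I" if "a \<in> I"
    using *[OF that, of b] \<open>subspace I\<close> bracket_swap[of a b] by (simp add: subspace_neg)
  show "(br b ^^ n) a \<in> I" if "a \<in> I"
    using that * by (induction n) auto
qed

lemma subalgebra_ideal_stab: "lie_ideal M I \<Longrightarrow> lie_subalgebra M (I \<inter> stab)"
  using subalgebra_Int[OF lie_ideal_imp_subalgebra subalgebra_stab] .

lemma \<phi>_0_stab: "\<phi> 0 ` stab = UNIV"
proof (rule generated)
  interpret S: lie_algebra "lie_restrict M stab" by (rule lie_algebra_restrict[OF subalgebra_stab])
  show "lie_subalgebra M (\<phi> 0 ` stab)"
    using S.subalgebra_image[OF hom_\<phi>_0[OF order_refl] lie_algebra_axioms S.subalgebra_carrier] by simp
  have "v \<in> stab" by (simp add: stab_def)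
  then show "d \<in> \<phi> 0 ` stab" by (metis \<phi>_0_v imageI)
  \<comment> \<open>The element \<open>v\<close> occurs in degree \<open>CHAR('k) - 1\<close> of its
    own image; that many derivations bring it to degree zero. As \<open>n > 0\<close>,
    \<open>w\<close> is a bracket and so lies in \<open>stab\<close>.\<close>
  define n where "n = CHAR('k) - Suc 0"
  then have n: "n = Suc (n - 1)" "n < CHAR('k)" using p_ge_2 by simp_all
  define w where "w = (br d ^^ n) v"
  have "w \<in> stab"
    unfolding w_def stab_def by (subst n) simp
  have "\<phi> 0 (lie_scale M (1 / pochhammer 1 n) w) = v"
    using pochhammer_1_neq_0[OF n(2)]
    by (simp add: w_def \<phi>_scale \<phi>_0_ad_d_power) (simp add: n_def)
  then show "v \<in> \<phi> 0 ` stab"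
    using subalgebraD(5)[OF subalgebra_stab \<open>w \<in> stab\<close>] by (metis imageI)
qed

text \<open>Since \<open>\<phi> 0\<close> maps \<open>stab\<close> onto everything, a bracket with
  an arbitrary element lifts to a bracket inside \<open>stab\<close>.\<close>

lemma lie_ideal_\<phi>_0:
  assumes "lie_ideal M I"
  shows "lie_ideal M (\<phi> 0 ` (I \<inter> stab))"
  unfolding lie_ideal_def
proof (intro conjI ballI)
  interpret S: lie_algebra "lie_restrict M stab" by (rule lie_algebra_restrict[OF subalgebra_stab])
  have "lie_subalgebra (lie_restrict M stab) (I \<inter> stab)"
    using subalgebra_ideal_stab[OF assms] by (simp add: lie_subalgebra_def)
  from S.subalgebra_image[OF hom_\<phi>_0[OF order_refl] lie_algebra_axioms this]
  show "subspace (\<phi> 0 ` (I \<inter> stab))" by (simp add: lie_subalgebra_def)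
  fix x y assume "y \<in> \<phi> 0 ` (I \<inter> stab)"
  then obtain b where b: "b \<in> I" "b \<in> stab" "y = \<phi> 0 b" by blast
  obtain a where a: "a \<in> stab" "x = \<phi> 0 a" using \<phi>_0_stab by (metis UNIV_I imageE)
  have "br x y = \<phi> 0 (br a b)" using a b \<phi>_0_bracket by simp
  then show "br x y \<in> \<phi> 0 ` (I \<inter> stab)"
    using a b lie_idealD(2)[OF assms] subalgebraD(7)[OF subalgebra_stab] by blast
qed auto

text \<open>\<open>stab\<close> is a proper subspace that maps onto the whole space: a basis
  \<open>B\<close> of \<open>stab\<close> together with \<open>d\<close> would be independent, yet
  spanned by at most \<open>card B\<close> images.\<close>

lemma not_finite_dim: "\<not> lie_finite_dim M"
proof
  assume "lie_finite_dim M"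
  then obtain A where A: "finite A" "span A = UNIV" by (auto simp: lie_finite_dim_def)
  obtain B where B: "B \<subseteq> stab" "independent B" "stab = span B"
    using maximal_independent_subset[of stab] span_subspace subalgebraD(1)[OF subalgebra_stab] by metis
  have finB: "finite B" and "card B \<le> card A"
    using independent_span_bound[OF A(1) B(2)] A(2) by auto
  have "d \<notin> span B" by (simp add: stab_def flip: B(3))
  have ind: "independent (insert d B)" "d \<notin> B"
    using B(2) \<open>d \<notin> span B\<close> span_base by (auto simp: independent_insert)
  have "x \<in> span (\<phi> 0 ` B)" for x
  proof -
    have "\<phi> 0 a \<in> span (\<phi> 0 ` B)" if "a \<in> span B" for a
      using that
    proof (induction rule: span_induct_alt)
      case (step r a b)
      then show ?case by (auto simp: \<phi>_add \<phi>_scale span_add span_scale span_base)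
    qed (simp add: span_zero)
    then show ?thesis using \<phi>_0_stab B(3) by (metis UNIV_I imageE)
  qed
  then have "insert d B \<subseteq> span (\<phi> 0 ` B)" by blast
  from independent_span_bound[OF _ ind(1) this]
  have "card (insert d B) \<le> card (\<phi> 0 ` B)" using finB by simp
  also have "\<dots> \<le> card B" using finB by (rule card_image_le)
  finally show False using ind(2) finB by simp
qed

section \<open>Ideals with the whole algebra as a subquotient\<close>

abbreviation rich :: "'v set \<Rightarrow> bool"
  where "rich I \<equiv> lie_subquotient M (lie_restrict M I)"

text \<open>\<open>\<phi> 0\<close> is a homomorphism on the subalgebra
  \<open>I \<inter> stab\<close> of \<open>I\<close>, so its image there is a subquotient of
  \<open>I\<close>.\<close>

lemma rich_\<phi>_0:
  assumes "lie_ideal M I" "rich (\<phi> 0 ` (I \<inter> stab))"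
  shows "rich I"
proof -
  have "rich (I \<inter> stab)"
    by (rule lie_subquotient_restrict_image[OF lie_algebra_axioms lie_algebra_axioms subalgebra_ideal_stab hom_\<phi>_0])
       (use assms in auto)
  then have "lie_subquotient M (lie_restrict (lie_restrict M I) (I \<inter> stab))" by simp
  from lie_subquotient_mono[OF this] show ?thesis by simp
qed

lemma rich_UNIV: "rich UNIV"
proof -
  have "lie_restrict M (lie_carrier M) = M" by (simp del: carrier)
  then have "lie_restrict M UNIV = M" by (simp only: carrier)
  then show ?thesis
    using subalgebra_carrier lie_hom_id_restrict[of UNIV M]
    unfolding lie_subquotient_def by (intro exI[of _ UNIV] exI[of _ "\<lambda>x. x"]) (simp only: carrier image_ident simp_thms)
qed

text \<open>Applying \<open>br d\<close> \<open>n\<close> times stays in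
  \<open>I \<inter> stab\<close> and makes \<open>n!\<close> times the coefficient
  \<open>\<phi> n a\<close> the constant one.\<close>

lemma coefficient_mem_\<phi>_0:
  assumes "lie_ideal M I" "a \<in> I" "c a = 0"
  shows "\<phi> n a \<in> \<phi> 0 ` (I \<inter> stab)"
proof (cases "n < CHAR('k)")
  case True
  have "(br d ^^ n) a \<in> I" by (rule lie_idealD(5)[OF assms(1,2)])
  moreover have "(br d ^^ n) a \<in> stab" using assms(3) by (cases n) (auto simp: stab_def)
  ultimately have "lie_scale M (pochhammer 1 n) (\<phi> n a) \<in> \<phi> 0 ` (I \<inter> stab)"
    unfolding \<phi>_0_ad_d_power[symmetric] by blast
  then have "lie_scale M (1 / pochhammer 1 n) (lie_scale M (pochhammer 1 n) (\<phi> n a)) \<in> \<phi> 0 ` (I \<inter> stab)"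
    by (rule lie_idealD(4)[OF lie_ideal_\<phi>_0[OF assms(1)]])
  then show ?thesis using pochhammer_1_neq_0[OF True] by simp
next
  case False
  then have "\<phi> n a = 0" by (simp add: \<phi>_beyond)
  then show ?thesis
    using lie_idealD(1)[OF lie_ideal_\<phi>_0[OF assms(1)]] subspace_0 by simp
qed

text \<open>Quantifying over all \<open>J\<close> allows repeated passage to coefficients.\<close>

lemma rich_if_coefficient:
  assumes "lie_ideal M I" "a \<in> I" "c a = 0"
    "\<And>J. lie_ideal M J \<Longrightarrow> \<phi> n a \<in> J \<Longrightarrow> rich J"
  shows "rich I"
  using assms rich_\<phi>_0 lie_ideal_\<phi>_0 coefficient_mem_\<phi>_0 by blast

text \<open>Both generators are coefficients of \<open>v\<close>, so a single evaluation already
  yields the whole algebra.\<close>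

lemma rich_if_v:
  assumes "lie_ideal M I" "v \<in> I"
  shows "rich I"
proof -
  let ?J = "\<phi> 0 ` (I \<inter> stab)"
  have "?J = UNIV"
  proof (rule generated)
    show "lie_subalgebra M ?J" using lie_ideal_imp_subalgebra lie_ideal_\<phi>_0 assms(1) by blast
    show "d \<in> ?J" "v \<in> ?J"
      using coefficient_mem_\<phi>_0[OF assms c_v, of 0] coefficient_mem_\<phi>_0[OF assms c_v, of "CHAR('k) - 1"]
      by simp_all
  qed
  then have "rich ?J" using rich_UNIV by simp
  then show ?thesis using rich_\<phi>_0 assms(1) by blast
qed

text \<open>
  If \<open>\<phi> 0 b = 0\<close> then the constant coefficient of \<open>[a, b]\<close> is \<open>c a\<close> times the linear coefficient
  of \<open>b\<close>. For \<open>p \<ge> 3\<close> a multiple of \<open>x \<otimes> v\<close> can serve as \<open>b\<close>, for \<open>p = 2\<close> the element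
  \<open>x \<otimes> [v, [d, v]]\<close>.
\<close>

lemma rich_if_c_neq_0:
  assumes "lie_ideal M I" "a \<in> I" "c a \<noteq> 0"
  shows "rich I"
proof -
  have key: "rich I"
    if "\<phi> 0 b = 0" "c b = 0" "\<And>J. lie_ideal M J \<Longrightarrow> \<phi> 1 b \<in> J \<Longrightarrow> rich J" for b
  proof (rule rich_if_coefficient[OF assms(1), of "br a b" 0])
    show "br a b \<in> I" using lie_idealD(3)[OF assms(1,2)] .
    fix J assume J: "lie_ideal M J" "\<phi> 0 (br a b) \<in> J"
    have "\<phi> 0 (br a b) = lie_scale M (c a) (\<phi> 1 b)"
      using p_ge_2 that by (simp add: \<phi>_bracket)
    then have "lie_scale M (1 / c a) (lie_scale M (c a) (\<phi> 1 b)) \<in> J"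
      using lie_idealD(4)[OF J, of "1 / c a"] by simp
    then show "rich J" using assms(3) that(3)[OF J(1)] by simp
  qed simp
  show ?thesis
  proof (cases "CHAR('k) = 2")
    case False
    \<comment> \<open>So many derivations kill \<open>1 \<otimes> d\<close> and turn
      \<open>x^(p-1) \<otimes> v\<close> into a nonzero multiple of
      \<open>x \<otimes> v\<close>.\<close>
    define n where "n = CHAR('k) - 2"
    have p: "CHAR('k) = Suc (Suc n)" "n \<noteq> 0" using p_ge_2 False by (simp_all add: n_def)
    show ?thesis
    proof (rule key[of "(br d ^^ n) v"])
      show "\<phi> 0 ((br d ^^ n) v) = 0" using p by (simp add: \<phi>_0_ad_d_power \<phi>_v)
      show "c ((br d ^^ n) v) = 0" by (cases n) auto
      fix J assume J: "lie_ideal M J" "\<phi> 1 ((br d ^^ n) v) \<in> J"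
      define r where "r = pochhammer (2 :: 'k) n"
      have "pochhammer 1 (Suc n) = r" by (simp add: r_def pochhammer_rec)
      then have "r \<noteq> 0" using pochhammer_1_neq_0[of "Suc n"] p by simp
      have "\<phi> 1 ((br d ^^ n) v) = lie_scale M r v"
        using p by (simp add: \<phi>_ad_d_power \<phi>_v flip: r_def)
      then have "lie_scale M (1 / r) (lie_scale M r v) \<in> J"
        using lie_idealD(4)[OF J, of "1 / r"] by simp
      then show "rich J" using \<open>r \<noteq> 0\<close> rich_if_v[OF J(1)] by simp
    qed
  next
    case True
    have two: "(2 :: 'k) = 0" using of_nat_CHAR[where ?'a = 'k] True by simp
    have v1: "\<phi> (Suc 0) v = v" using True by (simp add: \<phi>_v)
    have beyond: "\<phi> i a = 0" if "2 \<le> i" for i a using \<phi>_beyond that True by simp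
    \<comment> \<open>The self-similarity map sends \<open>e\<close> to
      \<open>1 \<otimes> v\<close>, \<open>w\<close> to \<open>1 \<otimes> e\<close> and
      \<open>br v w\<close> to \<open>x \<otimes> w\<close>; the last has constant term
      \<open>br d e = 0\<close>.\<close>
    define e where "e = br d v"
    define w where "w = br v e"
    have e: "\<phi> 0 e = v" "\<phi> (Suc 0) e = 0" "c e = 0"
      by (simp_all add: e_def \<phi>_br_d v1 two)
    have w: "\<phi> 0 w = e" "\<phi> (Suc 0) w = 0" "c w = 0"
      using True e by (simp_all add: w_def \<phi>_bracket v1 e_def[symmetric] beyond bracket_self)
    have "br d e = 0"
    proof (rule injective)
      show "\<phi> i (br d e) = 0" for i
        using e beyond[of "Suc i" e] by (cases i) (simp_all add: \<phi>_br_d)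
    qed simp
    have vw: "\<phi> 0 (br v w) = 0" "\<phi> (Suc 0) (br v w) = w"
      using True w \<open>br d e = 0\<close> by (simp_all add: \<phi>_bracket v1 beyond w_def[symmetric])
    show ?thesis
    proof (rule key[of "br v w"])
      \<comment> \<open>Constant coefficients descend from \<open>w\<close> to \<open>e\<close> to
        \<open>v\<close>.\<close>
      fix J assume "lie_ideal M J" "\<phi> 1 (br v w) \<in> J"
      then show "rich J"
        using rich_if_coefficient[of _ w 0] rich_if_coefficient[of _ e 0] rich_if_v
        by (simp add: vw w e)
    qed (simp_all add: vw)
  qed
qed

end

section \<open>Contraction and growth\<close>

text \<open>The larger root of the quadratic; it exceeds one because
  \<open>4 * p - 3 > 1\<close>.\<close>

lemma ex_weight:
  assumes "2 \<le> p"
  shows "\<exists>lam. 1 < lam \<and> lam * lam = lam + real p - 1"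
proof -
  define r where "r = sqrt (4 * real p - 3)"
  have "1 < r" "r * r = 4 * real p - 3" using assms by (simp_all add: r_def)
  then have "1 < (1 + r) / 2" "(1 + r) / 2 * ((1 + r) / 2) = (1 + r) / 2 + real p - 1"
    by (simp_all add: field_simps)
  then show ?thesis by blast
qed

context psz_structure
begin

lemma d_neq_0: "d \<noteq> 0"
  using c_d by fastforce

text \<open>If brackets with \<open>d\<close> vanish, so does \<open>\<phi> i\<close> for
  \<open>0 < i < CHAR('k)\<close>. The last of these fixes \<open>v\<close>, so
  \<open>v = 0\<close>, contrary to \<open>\<phi> 0 v = d\<close>.\<close>

lemma not_abelian: "\<not> lie_abelian M"
proof
  assume "lie_abelian M"
  then have comm: "br a b = 0" for a b by (simp add: lie_abelian_def)
  have "\<phi> i a = 0" if "0 < i" "i < CHAR('k)" for i a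
  proof -
    obtain j where j: "i = Suc j" using \<open>0 < i\<close> by (cases i) auto
    have "of_nat i \<noteq> (0 :: 'k)"
      using that unfolding of_nat_eq_0_iff_char_dvd by (auto dest: dvd_imp_le)
    moreover have "lie_scale M (of_nat i) (\<phi> i a) = 0"
      using \<phi>_br_d[of j a] comm[of d a] j by simp
    ultimately show ?thesis by simp
  qed
  from this[of "CHAR('k) - 1" v] have "v = 0" using p_ge_2 by simp
  then show False using \<phi>_0_v d_neq_0 by simp
qed

context
  fixes lam :: real
  assumes lam: "1 < lam" "lam * lam = lam + real CHAR('k) - 1"
begin

text \<open>
  The filtration by weight, where \<open>d\<close> has weight \<open>1\<close> and \<open>v\<close> has weight \<open>lam\<close>. The choice of
  \<open>lam\<close> makes both summands of \<open>1 \<otimes> d + x\<^sup>p\<^sup>-\<^sup>1 \<otimes> v\<close> compatible with the filtration when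
  the weight of \<open>x\<^sup>i \<otimes> a\<close> is \<open>lam\<close> times the weight of \<open>a\<close>, minus \<open>i\<close>.
\<close>

inductive filt :: "real \<Rightarrow> 'v \<Rightarrow> bool"
  where
    filt_zero: "filt D 0"
  | filt_d: "1 \<le> D \<Longrightarrow> filt D d"
  | filt_v: "lam \<le> D \<Longrightarrow> filt D v"
  | filt_add: "filt D a \<Longrightarrow> filt D b \<Longrightarrow> filt D (a + b)"
  | filt_scale: "filt D a \<Longrightarrow> filt D (lie_scale M r a)"
  | filt_br: "filt D a \<Longrightarrow> filt E b \<Longrightarrow> D + E \<le> G \<Longrightarrow> filt G (br a b)"

lemma filt_mono: "filt D a \<Longrightarrow> D \<le> E \<Longrightarrow> filt E a"
proof (induction arbitrary: E rule: filt.induct)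
  case (filt_br D a D' b G)
  then show ?case by (intro filt.filt_br[of D a D' b]) auto
qed (auto intro: filt.intros)

lemma filt_diff: "filt D a \<Longrightarrow> filt D b \<Longrightarrow> filt D (a - b)"
  using filt_add[OF _ filt_scale[of D b "-1"]] by simp

lemma filt_sum: "(\<And>i. i \<in> A \<Longrightarrow> filt D (f i)) \<Longrightarrow> filt D (sum f A)"
  by (induction A rule: infinite_finite_induct) (auto intro: filt_zero filt_add)

lemma subspace_filt: "subspace {a. filt D a}"
  by (simp add: subspace_def filt_zero filt_add filt_scale)

lemma ex_filt: "\<exists>D. filt D a"
proof -
  have "{a. \<exists>D. filt D a} = UNIV"
  proof (rule generated)
    have "\<exists>D. filt D (a + b)" if "filt D a" "filt E b" for a b D E
      using filt_add[OF filt_mono[OF that(1)] filt_mono[OF that(2)], of "max D E"] by auto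
    moreover have "\<exists>D. filt D (br a b)" if "filt D a" "filt E b" for a b D E
      using filt_br[OF that order_refl] by blast
    ultimately show "lie_subalgebra M {a. \<exists>D. filt D a}"
      by (auto simp: lie_subalgebra_def subspace_def intro: filt_zero filt_scale)
  qed (auto intro: filt_d filt_v)
  then show ?thesis by blast
qed

text \<open>The bounds need a joint induction: in a bracket of weight below \<open>lam + 1\<close>,
  either a factor has weight below one and is zero, or both have weight below \<open>lam\<close> and
  are multiples of \<open>d\<close>.\<close>

lemma filt_small:
  "filt D a \<Longrightarrow> (D < 1 \<longrightarrow> a = 0) \<and> (D < lam \<longrightarrow> a \<in> span {d}) \<and> (D < lam + 1 \<longrightarrow> a \<in> span {d, v})"
proof (induction rule: filt.induct)
  case (filt_br D a E b G)
  have "br a b = 0" if "G < lam + 1"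
  proof (cases "D < 1 \<or> E < 1")
    case True
    then show ?thesis using filt_br.IH by auto
  next
    case False
    then have "D < lam" "E < lam" using that filt_br.hyps(3) by auto
    then obtain r s where "a = lie_scale M r d" "b = lie_scale M s d"
      using filt_br.IH unfolding span_singleton by auto
    then show ?thesis by (simp add: bracket_scale_left bracket_scale_right bracket_self)
  qed
  then show ?case using lam(1) by (auto simp: span_zero)
qed (use lam(1) in \<open>auto simp: span_zero span_base span_add span_scale\<close>)

text \<open>In a bracket, the derivation part of one factor shifts an index of the other from
  \<open>i + 1\<close> to \<open>i\<close>. The weight of the first factor pays for this unit, being
  at least one unless its \<open>c\<close> vanishes; hence the joint claim.\<close>

lemma filt_\<phi>:
  "filt D a \<Longrightarrow> (D < 1 \<longrightarrow> c a = 0) \<and> (\<forall>i. filt ((D + real i) / lam) (\<phi> i a))"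
proof (induction rule: filt.induct)
  case (filt_d D)
  then show ?case by (auto intro: filt_zero)
next
  case (filt_v D)
  \<comment> \<open>The top coefficient of \<open>v\<close> is again \<open>v\<close>; this
    requirement dictates the equation for \<open>lam\<close>.\<close>
  have "lam \<le> (D + real (CHAR('k) - 1)) / lam"
    using filt_v lam p_ge_2 by (simp add: field_simps)
  moreover have "1 \<le> D / lam" using filt_v lam by (simp add: field_simps)
  ultimately show ?case by (auto simp: \<phi>_v intro: filt_zero filt.filt_d filt.filt_v)
next
  case (filt_br D a E b G)
  have "filt ((G + real i) / lam) (\<phi> i (br a b))" for i
  proof (cases "i < CHAR('k)")
    case True
    have 1: "filt ((G + real i) / lam) (br (\<phi> j a) (\<phi> (i - j) b))" if "j \<le> i" for j
    proof (rule filt.filt_br)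
      show "filt ((D + real j) / lam) (\<phi> j a)" "filt ((E + real (i - j)) / lam) (\<phi> (i - j) b)"
        using filt_br.IH by blast+
      show "(D + real j) / lam + (E + real (i - j)) / lam \<le> (G + real i) / lam"
        using that filt_br.hyps(3) lam(1) by (simp add: divide_right_mono of_nat_diff flip: add_divide_distrib)
    qed
    have 2: "filt ((G + real i) / lam) (lie_scale M (c a * r) (\<phi> (Suc i) b))" for r
    proof (cases "D < 1")
      case False
      then have "(E + real (Suc i)) / lam \<le> (G + real i) / lam"
        using lam(1) filt_br.hyps(3) by (simp add: divide_right_mono)
      then show ?thesis using filt_br.IH by (intro filt_scale) (blast intro: filt_mono)
    qed (use filt_br.IH in \<open>simp add: filt_zero\<close>)
    have 3: "filt ((G + real i) / lam) (lie_scale M (c b * r) (\<phi> (Suc i) a))" for r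
    proof (cases "E < 1")
      case False
      then have "(D + real (Suc i)) / lam \<le> (G + real i) / lam"
        using lam(1) filt_br.hyps(3) by (simp add: divide_right_mono)
      then show ?thesis using filt_br.IH by (intro filt_scale) (blast intro: filt_mono)
    qed (use filt_br.IH in \<open>simp add: filt_zero\<close>)
    show ?thesis
      unfolding \<phi>_bracket[OF True] by (intro filt_diff filt_add filt_sum 1 2 3) simp
  qed (simp add: \<phi>_beyond filt_zero)
  then show ?case by simp
qed (auto simp: c_add c_scale \<phi>_add \<phi>_scale intro: filt.intros)

text \<open>\<open>lam\<close> is the fixed point of \<open>D \<mapsto> (D + p - 1) / lam\<close>,
  the worst bound over \<open>i < p\<close>, so the excess over \<open>lam\<close> is divided by
  \<open>lam\<close>.\<close>

lemma filt_contract: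
  assumes "filt (lam + E) a"
  shows "filt (lam + E / lam) (\<phi> i a)"
proof (cases "i < CHAR('k)")
  case True
  have "(lam + E + real i) / lam \<le> (lam * lam + E) / lam"
    using True lam by (intro divide_right_mono) auto
  also have "\<dots> = lam + E / lam" using lam(1) by (simp add: field_simps)
  finally have "(lam + E + real i) / lam \<le> lam + E / lam" .
  then show ?thesis using filt_\<phi>[OF assms] filt_mono by blast
qed (simp add: \<phi>_beyond filt_zero)

text \<open>Passing to a nonzero coefficient divides the excess \<open>E\<close> by
  \<open>lam\<close>, until \<open>E < 1\<close> leaves only combinations of \<open>d\<close> and
  \<open>v\<close>; an element with \<open>c a \<noteq> 0\<close> ends the descent at once.\<close>

lemma rich_filt:
  assumes "lie_ideal M I" "a \<in> I" "a \<noteq> 0" "filt (lam + E) a" "E < lam ^ n"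
  shows "rich I"
  using assms
proof (induction n arbitrary: I a E)
  case 0
  then have "a \<in> span {d, v}" using filt_small[OF 0(4)] by simp
  then obtain r s where a: "a = lie_scale M r d + lie_scale M s v"
    by (auto simp: span_insert span_singleton algebra_simps)
  show ?case
  proof (cases "r = 0")
    case True
    then have "s \<noteq> 0" using a 0 by auto
    moreover have "lie_scale M (1 / s) a \<in> I" using lie_idealD(4) 0 by blast
    ultimately show ?thesis using rich_if_v a 0 True by simp
  next
    case False
    then have "c a \<noteq> 0" by (simp add: a c_add c_scale)
    then show ?thesis using rich_if_c_neq_0 0 by blast
  qed
next
  case (Suc n)
  show ?case
  proof (cases "c a = 0")
    case True
    then obtain i where i: "\<phi> i a \<noteq> 0" using injective Suc.prems(3) by blast
    have "E / lam < lam ^ n" using Suc.prems(5) lam(1) by (simp add: field_simps)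
    then show ?thesis
      using rich_if_coefficient[OF Suc.prems(1,2) True, of i]
        Suc.IH[OF _ _ i filt_contract[OF Suc.prems(4)]] by blast
  next
    case False
    then show ?thesis using rich_if_c_neq_0 Suc.prems by blast
  qed
qed

lemma nonzero_ideal_rich:
  assumes "lie_ideal M I" "I \<noteq> {0}"
  shows "rich I"
proof -
  obtain a where a: "a \<in> I" "a \<noteq> 0"
    using assms(2) subspace_0[OF lie_idealD(1)[OF assms(1)]] by blast
  obtain D where "filt D a" using ex_filt by blast
  then have D: "filt (lam + (D - lam)) a" by simp
  obtain n where "D - lam < lam ^ n" using real_arch_pow[OF lam(1)] by blast
  from rich_filt[OF assms(1) a D this] show ?thesis .
qed

section \<open>Polynomial growth of the filtration\<close>

lemma filt_card_independent:
  assumes B: "finite B" "{a. filt (lam + E / lam) a} \<subseteq> span B"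
    and A: "independent A" "A \<subseteq> {a. filt (lam + E) a}"
  shows "finite A \<and> card A \<le> Suc (CHAR('k) * card B)"
proof -
  define fscale :: "'k \<Rightarrow> (nat \<Rightarrow> 'v) \<Rightarrow> nat \<Rightarrow> 'v"
    where "fscale r f = (\<lambda>i. lie_scale M r (f i))" for r f
  define single :: "nat \<Rightarrow> 'v \<Rightarrow> nat \<Rightarrow> 'v"
    where "single i b = (\<lambda>j. if j = i then b else 0)" for i b
  \<comment> \<open>The whole self-similarity map as one injective linear map: \<open>c a\<close> is
    stored as a multiple of \<open>d \<noteq> 0\<close> in position \<open>CHAR('k)\<close>, where
    all coefficients vanish.\<close>
  define \<Phi> where "\<Phi> a = (\<lambda>i. \<phi> i a) + single CHAR('k) (lie_scale M (c a) d)" for a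
  interpret W: vector_space fscale
    by unfold_locales (auto simp: fscale_def fun_eq_iff scale_left_distrib scale_right_distrib)
  have "module_hom (lie_scale M) fscale \<Phi>"
    by unfold_locales
       (auto simp: fscale_def \<Phi>_def single_def fun_eq_iff scale_left_distrib scale_right_distrib
         \<phi>_add \<phi>_scale c_add c_scale)
  moreover have "inj \<Phi>"
  proof (rule injI)
    fix a b assume eq: "\<Phi> a = \<Phi> b"
    have "\<phi> i a = \<phi> i b" for i
      using fun_cong[OF eq, of i] \<phi>_beyond[of i]
      by (cases "i < CHAR('k)") (simp_all add: \<Phi>_def single_def)
    moreover have "c a = c b"
      using fun_cong[OF eq, of "CHAR('k)"] \<phi>_beyond[of "CHAR('k)"] d_neq_0
      by (simp add: \<Phi>_def single_def)
    moreover have "\<phi> i (a - b) = \<phi> i a - \<phi> i b" "c (a - b) = c a - c b" for i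
      using \<phi>_add[of i "a - b" b] c_add[of "a - b" b] by simp_all
    ultimately show "a = b" using injective[of "a - b"] by simp
  qed
  ultimately have ind: "W.independent (\<Phi> ` A)"
    using A(1) module_hom.independent_inj_image by blast
  \<comment> \<open>One copy of \<open>B\<close> in each position below \<open>CHAR('k)\<close>, and
    one vector for the derivation part.\<close>
  define G where "G = insert (single CHAR('k) d) ((\<lambda>(i, b). single i b) ` ({..<CHAR('k)} \<times> B))"
  have "finite G" using B(1) by (simp add: G_def)
  have "card G \<le> Suc (card ((\<lambda>(i, b). single i b) ` ({..<CHAR('k)} \<times> B)))"
    unfolding G_def using B(1) by (simp add: card_insert_if)
  also have "\<dots> \<le> Suc (CHAR('k) * card B)"
    using card_image_le[of "{..<CHAR('k)} \<times> B" "\<lambda>(i, b). single i b"] B(1)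
    by (simp add: card_cartesian_product)
  finally have card_G: "card G \<le> Suc (CHAR('k) * card B)" .
  have single_scale: "single i (lie_scale M r b) = fscale r (single i b)"
    and single_add: "single i (a + b) = single i a + single i b" and single_0: "single i 0 = 0" for i r a b
    by (auto simp: single_def fscale_def fun_eq_iff)
  have single: "single i b \<in> W.span G" if "b \<in> span B" "i < CHAR('k)" for i b
    using that(1)
  proof (induction rule: span_induct_alt)
    case base
    show ?case unfolding single_0 by (rule W.span_zero)
  next
    case (step r a b)
    have "single i a \<in> G" using step that(2) by (auto simp: G_def)
    then show ?case
      unfolding single_add single_scale by (intro W.span_add W.span_scale W.span_base step.IH)
  qed
  have "\<Phi> ` A \<subseteq> W.span G"
  proof
    fix y assume "y \<in> \<Phi> ` A"
    then obtain a where a: "a \<in> A" "y = \<Phi> a" by blast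
    have "y = (\<Sum>i<CHAR('k). single i (\<phi> i a)) + fscale (c a) (single CHAR('k) d)"
      unfolding single_scale[symmetric] a \<Phi>_def
      by (auto simp: fun_eq_iff sum_fun_apply single_def \<phi>_beyond)
    moreover have "\<phi> i a \<in> span B" for i
      using filt_contract A(2) a B(2) by blast
    moreover have "single CHAR('k) d \<in> W.span G" by (simp add: G_def W.span_base)
    ultimately show "y \<in> W.span G"
      by (metis (no_types, lifting) W.span_add W.span_sum W.span_scale single lessThan_iff)
  qed
  from W.independent_span_bound[OF \<open>finite G\<close> ind this]
  have "finite (\<Phi> ` A)" "card (\<Phi> ` A) \<le> card G" by auto
  moreover have "inj_on \<Phi> A" using \<open>inj \<Phi>\<close> by (simp add: inj_on_def)
  ultimately show ?thesis
    using card_G by (simp add: finite_image_iff card_image)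
qed

text \<open>The strict bound absorbs the extra dimension at each step:
  \<open>1 + p * b < p * (b + 1)\<close> for \<open>p \<ge> 2\<close>.\<close>

lemma filt_card_span:
  "E < lam ^ n \<Longrightarrow> \<exists>B. finite B \<and> card B < 3 * CHAR('k) ^ n \<and> {a. filt (lam + E) a} \<subseteq> span B"
proof (induction n arbitrary: E)
  case 0
  then have "{a. filt (lam + E) a} \<subseteq> span {d, v}" using filt_small by fastforce
  moreover have "card {d, v} < 3" by (simp add: card_insert_if)
  ultimately show ?case by (intro exI[of _ "{d, v}"]) simp
next
  case (Suc n)
  then have "E / lam < lam ^ n" using lam(1) by (simp add: field_simps)
  from Suc.IH[OF this] obtain B
    where B: "finite B" "card B < 3 * CHAR('k) ^ n" "{a. filt (lam + E / lam) a} \<subseteq> span B" by blast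
  obtain A where A: "A \<subseteq> {a. filt (lam + E) a}" "independent A" "{a. filt (lam + E) a} \<subseteq> span A"
    using maximal_independent_subset[of "{a. filt (lam + E) a}"] by blast
  have "finite A" "card A \<le> Suc (CHAR('k) * card B)"
    using filt_card_independent[OF B(1,3) A(2,1)] by auto
  moreover have "CHAR('k) * Suc (card B) \<le> CHAR('k) * (3 * CHAR('k) ^ n)"
    using B(2) by (intro mult_le_mono2) simp
  then have "Suc (CHAR('k) * card B) < 3 * CHAR('k) ^ Suc n" using p_ge_2 by simp
  ultimately show ?case using A(3) by (intro exI[of _ A]) auto
qed

lemma filt_card_polynomial:
  "\<exists>C s. C > 0 \<and> (\<forall>n\<ge>1. \<exists>B. finite B \<and> real (card B) \<le> C * real n ^ s \<and> {a. filt (lam * real n) a} \<subseteq> span B)"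
proof -
  \<comment> \<open>This bounds \<open>p^k\<close> by \<open>(lam^k)^s\<close>, a polynomial in
    \<open>n\<close> once \<open>lam^k\<close> is bounded linearly in \<open>n\<close>.\<close>
  obtain s where s: "real CHAR('k) < lam ^ s" using real_arch_pow[OF lam(1)] by blast
  have "\<exists>B. finite B \<and> real (card B) \<le> 3 * (lam * lam) ^ s * real n ^ s \<and> {a. filt (lam * real n) a} \<subseteq> span B"
    if "n \<ge> 1" for n
  proof -
    \<comment> \<open>Minimality yields \<open>lam^k \<le> lam * lam * n\<close>; \<open>k\<close>
      is positive because \<open>lam * n \<ge> 1\<close>.\<close>
    define k where "k = (LEAST k. lam * real n < lam ^ k)"
    have k: "lam * real n < lam ^ k"
      unfolding k_def using real_arch_pow[OF lam(1)] by (rule LeastI_ex)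
    have "1 \<le> lam * real n" using lam(1) that mult_mono[of 1 lam 1 "real n"] by simp
    then have "k \<noteq> 0" using k by (intro notI) simp
    then obtain l where l: "k = Suc l" by (cases k) auto
    then have "lam ^ l \<le> lam * real n"
      using not_less_Least[of l "\<lambda>k. lam * real n < lam ^ k"] by (simp add: k_def)
    then have le: "lam ^ k \<le> lam * lam * real n" using lam(1) l by simp
    have "lam * real n - lam < lam ^ k" using k lam(1) by simp
    from filt_card_span[OF this] obtain B where
      B: "finite B" "card B < 3 * CHAR('k) ^ k" "{a. filt (lam * real n) a} \<subseteq> span B" by auto
    have "real (card B) \<le> real (3 * CHAR('k) ^ k)" using B(2) by linarith
    also have "\<dots> \<le> 3 * (lam ^ s) ^ k" using s by (simp add: power_mono)
    also have "\<dots> = 3 * (lam ^ k) ^ s" by (simp add: mult.commute flip: power_mult)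
    also have "\<dots> \<le> 3 * (lam * lam * real n) ^ s"
      using le lam(1) by (simp add: power_mono)
    also have "\<dots> = 3 * (lam * lam) ^ s * real n ^ s" by (simp add: power_mult_distrib)
    finally show ?thesis using B by blast
  qed
  then show ?thesis
    using lam(1) by (intro exI[of _ "3 * (lam * lam) ^ s"] exI[of _ s]) simp
qed

end

lemma not_in_EL:
  assumes "lie_subquotient M L"
  shows "L \<notin> EL"
proof -
  obtain lam where "1 < lam" "lam * lam = lam + real CHAR('k) - 1"
    using ex_weight[OF p_ge_2] by blast
  note rich = nonzero_ideal_rich[OF this]
  show ?thesis
    by (rule not_in_EL_if_subquotient[of M "{d, v}"])
       (use assms lie_algebra_axioms not_finite_dim not_abelian rich generated in auto)
qed

text \<open>Both generators have weight at most \<open>lam\<close>, so the ball of radius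
  \<open>n\<close> lies in the image of weight at most \<open>lam * n\<close>. Working with images
  covers every isomorphic copy.\<close>

lemma subexp_growth_image:
  fixes L :: "('k, 'w::ab_group_add) lie_alg"
  assumes "lie_algebra L" "lie_hom M L f" "f ` UNIV = lie_carrier L"
  shows "lie_subexp_growth L"
proof -
  interpret L: lie_algebra L by fact
  obtain lam where lam: "1 < lam" "lam * lam = lam + real CHAR('k) - 1"
    using ex_weight[OF p_ge_2] by blast
  have f: "f (a + b) = f a + f b" "f (lie_scale M r a) = lie_scale L r (f a)"
    "f (br a b) = lie_bracket L (f a) (f b)" for a b r
    using assms(2) by (simp_all add: lie_hom_def)
  interpret f: module_hom "lie_scale M" "lie_scale L" f
    by unfold_locales (auto simp: f)
  define F where "F = L.span {f d, f v}"
  define V where "V n = f ` {a. filt lam (lam * real n) a}" for n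
  have V: "L.subspace (V n)" for n
    unfolding V_def using subspace_filt[OF lam] by (rule f.subspace_image)
  have F: "F \<subseteq> V 1"
    unfolding F_def
  proof (rule L.span_minimal[OF _ V])
    have "filt lam lam d" "filt lam lam v" using lam(1) filt_d[OF lam] filt_v[OF lam] by auto
    then show "{f d, f v} \<subseteq> V 1" by (auto simp: V_def)
  qed
  have V_br: "lie_bracket L a b \<in> V (m + n)" if "a \<in> V m" "b \<in> V n" for a b m n
    using that by (auto simp: V_def algebra_simps simp flip: f(3) intro!: imageI filt_br[OF lam])
  have V_Suc: "V n \<subseteq> V (Suc n)" for n
    using lam(1) filt_mono[OF lam, of "lam * real n" _ "lam * real (Suc n)"] by (auto simp: V_def algebra_simps)
  have ball: "lie_ball L F n \<subseteq> V n" for n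
  proof (induction n rule: induct_nat_012)
    case 0
    then show ?case using L.subspace_0[OF V] by simp
  next
    case 1
    then show ?case using F by simp
  next
    case (ge2 n)
    have "{lie_bracket L b' g | b' g. b' \<in> lie_ball L F (Suc n) \<and> g \<in> F} \<subseteq> V (Suc (Suc n))"
      using ge2(2) F V_br[of _ "Suc n" _ 1] by auto
    then have span: "L.span {lie_bracket L b' g | b' g. b' \<in> lie_ball L F (Suc n) \<and> g \<in> F} \<subseteq> V (Suc (Suc n))"
      using V by (rule L.span_minimal)
    have ball: "lie_ball L F (Suc n) \<subseteq> V (Suc (Suc n))" using ge2(2) V_Suc by blast
    show ?case
    proof
      fix x assume "x \<in> lie_ball L F (Suc (Suc n))"
      then obtain b c where "b \<in> V (Suc (Suc n))" "c \<in> V (Suc (Suc n))" "x = b + c"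
        using span ball by auto
      then show "x \<in> V (Suc (Suc n))" using L.subspace_add[OF V] by blast
    qed
  qed
  have FL: "F \<subseteq> lie_carrier L" using F assms(3) by (auto simp: V_def)
  have "S = lie_carrier L" if S: "lie_subalgebra L S" "F \<subseteq> S" for S
  proof -
    have "{a. f a \<in> S} = UNIV"
    proof (rule generated)
      show "lie_subalgebra M {a. f a \<in> S}" using subalgebra_vimage[OF assms(2,1) S(1)] by simp
      have "f d \<in> F" "f v \<in> F" by (simp_all add: F_def L.span_base)
      then show "d \<in> {a. f a \<in> S}" "v \<in> {a. f a \<in> S}" using S(2) by auto
    qed
    then have "f ` UNIV \<subseteq> S" by auto
    then show "S = lie_carrier L" using assms(3) L.subalgebraD(2)[OF S(1)] by simp
  qed
  then have gen: "\<Inter>{S. lie_subalgebra L S \<and> F \<subseteq> S} = lie_carrier L"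
    using L.subalgebra_carrier FL by blast
  obtain C s where C: "C > 0"
    "\<And>n. n \<ge> 1 \<Longrightarrow> \<exists>B. finite B \<and> real (card B) \<le> C * real n ^ s \<and> {a. filt lam (lam * real n) a} \<subseteq> span B"
    using filt_card_polynomial[OF lam] by blast
  have "L.dim (lie_ball L F n) \<le> C * real n ^ s" if n: "n \<ge> 1" for n
  proof -
    obtain B where B: "finite B" "real (card B) \<le> C * real n ^ s" "{a. filt lam (lam * real n) a} \<subseteq> span B"
      using C(2)[OF n] by blast
    have "lie_ball L F n \<subseteq> L.span (f ` B)"
      using ball[of n] B(3) f.span_image[of B] unfolding V_def by blast
    then have "L.dim (lie_ball L F n) \<le> card (f ` B)" using L.dim_le_card B(1) by blast
    also have "\<dots> \<le> card B" using B(1) by (rule card_image_le)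
    finally show ?thesis using B(2) by linarith
  qed
  then have "eventually (\<lambda>n. ereal (root n (real (L.dim (lie_ball L F n)))) \<le> ereal (root n (C * real n ^ s))) sequentially"
    unfolding eventually_sequentially by (intro exI[of _ 1]) simp
  then have "limsup (\<lambda>n. ereal (root n (real (L.dim (lie_ball L F n))))) \<le> limsup (\<lambda>n. ereal (root n (C * real n ^ s)))"
    by (rule Limsup_mono)
  also have "limsup (\<lambda>n. ereal (root n (C * real n ^ s))) = 1"
  proof -
    \<comment> \<open>The \<open>n\<close>-th roots of \<open>C\<close> and of \<open>n\<close> both
      tend to one.\<close>
    have "(\<lambda>n. root n C * root n (real n) ^ s) \<longlonglongrightarrow> 1 * 1 ^ s"
      by (intro tendsto_intros LIMSEQ_root LIMSEQ_root_const C)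
    moreover have "\<forall>\<^sub>F n in sequentially. root n C * root n (real n) ^ s = root n (C * real n ^ s)"
      unfolding eventually_sequentially
      by (intro exI[of _ 1]) (simp add: real_root_mult real_root_power)
    ultimately have "(\<lambda>n. root n (C * real n ^ s)) \<longlonglongrightarrow> 1"
      using filterlim_cong by fastforce
    then show ?thesis
      by (intro lim_imp_Limsup) (auto simp: one_ereal_def)
  qed
  finally have growth: "limsup (\<lambda>n. ereal (root n (real (L.dim (lie_ball L F n))))) \<le> 1" .
  have fin: "\<exists>B. finite B \<and> F = L.span B"
    unfolding F_def by (intro exI[of _ "{f d, f v}"]) simp
  show ?thesis
    unfolding lie_subexp_growth_def by (rule exI[of _ F]) (simp add: gen FL fin growth)
qed

end

section \<open>The concrete algebra as an instance of the axioms\<close>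

lemma psz_structure_psz_alg:
  assumes p: "prime CHAR('k::field)"
  shows "psz_structure (psz_alg :: ('k, 'k psz) lie_alg) psz_d psz_v psz_der psz_coeff"
proof -
  have p_pos: "CHAR('k) > 0" and p_ge_2: "2 \<le> CHAR('k)"
    using p by (auto simp: prime_gt_0_nat prime_ge_2_nat)
  interpret F: lie_algebra "free_lie_alg :: ('k, ('k, psz_gen) free_lie) lie_alg"
    by (rule lie_algebra_free_lie_alg)
  note abs_eqs = psz_coeff.abs_eq psz_der.abs_eq plus_psz.abs_eq minus_psz.abs_eq
    psz_scale.abs_eq psz_bracket.abs_eq
  have abs_sum: "abs_psz (sum f A) = (\<Sum>i\<in>A. abs_psz (f i))"
    for f :: "nat \<Rightarrow> ('k, psz_gen) free_lie" and A
    by (induction A rule: infinite_finite_induct) (simp_all add: zero_psz.abs_eq flip: plus_psz.abs_eq)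
  show ?thesis
  proof (rule psz_structure.intro[OF lie_algebra_psz_alg], rule psz_structure_axioms.intro)
    fix a b :: "'k psz" and r :: 'k and i :: nat
    obtain a' where "a = abs_psz a'" using psz_abs_cases by blast
    moreover obtain b' where "b = abs_psz b'" using psz_abs_cases by blast
    ultimately have ab: "a = abs_psz a'" "b = abs_psz b'" .
    show "psz_der (a + b) = psz_der a + psz_der b" by (simp add: ab abs_eqs psz_psi_der_add)
    show "psz_der (lie_scale psz_alg r a) = r * psz_der a" by (simp add: ab abs_eqs psz_psi_der_scale)
    show "psz_der (lie_bracket psz_alg a b) = 0"
      using p_pos by (simp add: ab abs_eqs psz_psi_der_bracket)
    show "psz_coeff i (a + b) = psz_coeff i a + psz_coeff i b" by (simp add: ab abs_eqs psz_psi_add)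
    show "psz_coeff i (lie_scale psz_alg r a) = lie_scale psz_alg r (psz_coeff i a)"
      by (cases "psz_psi a'") (simp add: ab abs_eqs psz_psi_scale semidirect_simps)
    show "psz_coeff i a = 0" if "CHAR('k) \<le> i"
      using that by (simp add: ab abs_eqs psz_psi_beyond zero_psz.abs_eq)
    show "psz_coeff i (lie_bracket psz_alg a b) =
        (\<Sum>j\<le>i. lie_bracket psz_alg (psz_coeff j a) (psz_coeff (i - j) b))
        + lie_scale psz_alg (psz_der a * of_nat (Suc i)) (psz_coeff (Suc i) b)
        - lie_scale psz_alg (psz_der b * of_nat (Suc i)) (psz_coeff (Suc i) a)" if "i < CHAR('k)"
      using that p_pos
      by (simp add: ab abs_eqs psz_psi_coeff_bracket abs_sum[symmetric] del: of_nat_Suc)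
    \<comment> \<open>Zero coefficients in the quotient are coefficients in \<open>psz_ideal\<close>
      for a representative, which then lies in \<open>psz_ideal\<close> itself because this is the
      union of all stages.\<close>
    show "a = 0" if "psz_der a = 0" "\<And>i. psz_coeff i a = 0"
    proof -
      have coeff: "fst (psz_psi a') i \<in> psz_ideal" for i
        using that(2)[of i] by (simp add: ab abs_eqs zero_psz.abs_eq psz.abs_eq_iff)
      have "psz_psi_der a' = 0" using that(1) by (simp add: ab abs_eqs)
      from mem_psz_idealI[OF p_pos this coeff] show ?thesis
        by (simp add: ab zero_psz.abs_eq psz.abs_eq_iff)
    qed
  next
    fix i
    have one: "xcoeff (1 :: 'k trunc_poly) j = (if j = 0 then 1 else 0)" for j
      using xcoeff_xvar_power'[of 0 j, where ?'k = 'k] p_pos by auto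
    show "psz_der (psz_d :: 'k psz) = 1" "psz_der (psz_v :: 'k psz) = 0"
      by (simp_all add: psz_d.abs_eq psz_v.abs_eq abs_eqs psz_psi_der_def psz_psi partial_x_xvar one)
    show "psz_coeff i (psz_d :: 'k psz) = 0"
      by (simp add: psz_d.abs_eq abs_eqs psz_psi zero_psz.abs_eq)
    show "psz_coeff i (psz_v :: 'k psz) = (if i = 0 then psz_d else if i = CHAR('k) - 1 then psz_v else 0)"
      using p_ge_2 F.scale_zero_left F.scale_one
      by (auto simp: psz_d.abs_eq psz_v.abs_eq abs_eqs psz_psi zero_psz.abs_eq tensor_def one
          xcoeff_xvar_power')
  next
    fix S assume S: "lie_subalgebra (psz_alg :: ('k, 'k psz) lie_alg) S" "psz_d \<in> S" "psz_v \<in> S"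
    interpret P: lie_algebra "psz_alg :: ('k, 'k psz) lie_alg" by (rule lie_algebra_psz_alg)
    note SD = P.subalgebraD[OF S(1), simplified]
    have "abs_psz a \<in> S" for a
    proof (induction a rule: free_lie_induct)
      case (gen x)
      then show ?case using S by (cases x) (simp_all add: psz_d.abs_eq psz_v.abs_eq)
    qed (use SD in \<open>simp_all flip: abs_eqs zero_psz.abs_eq\<close>)
    then have "a \<in> S" for a using psz_abs_cases[of a] by blast
    then show "S = UNIV" by blast
  qed (use p in simp_all)
qed

text \<open>\<open>SL\<close> and \<open>EL\<close> concern algebras carried by one type; an
  arbitrary isomorphic copy \<open>L\<close> lets that type vary.\<close>

theorem theorem5p4:
  fixes p :: nat and L :: "('k::field, 'v::ab_group_add) lie_alg"
  assumes "prime p" and "CHAR('k) = p"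
    and "lie_algebra L" and "lie_isomorphic (psz_alg :: ('k, 'k psz) lie_alg) L"
  shows "L \<in> SL \<and> L \<notin> EL"
proof
  interpret P: psz_structure "psz_alg :: ('k, 'k psz) lie_alg" psz_d psz_v psz_der psz_coeff
    using assms(1,2) by (intro psz_structure_psz_alg) simp
  obtain f where f: "lie_hom (psz_alg :: ('k, 'k psz) lie_alg) L f" "bij_betw f UNIV (lie_carrier L)"
    using assms(4) by (auto simp: lie_isomorphic_def)
  then have onto: "f ` UNIV = lie_carrier L" by (simp add: bij_betw_def)
  show "L \<in> SL"
    using lie_closure.base[OF assms(3)] P.subexp_growth_image[OF assms(3) f(1) onto] by (simp add: SL_def)
  \<comment> \<open>The inverse isomorphism exhibits the algebra as a subquotient of
    \<open>L\<close>.\<close>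
  define g where "g = inv f"
  have gf: "g (f x) = x" for x using f(2) by (simp add: g_def bij_betw_def)
  have f': "f x + f y = f (x + y)" "lie_scale L c (f x) = f (psz_scale c x)"
    "lie_bracket L (f x) (f y) = f (psz_bracket x y)" for x y c
    using f(1) by (simp_all add: lie_hom_def)
  have "lie_hom (lie_restrict L (lie_carrier L)) (psz_alg :: ('k, 'k psz) lie_alg) g"
    unfolding lie_hom_def by (auto simp: gf f' simp flip: onto)
  moreover have "g ` lie_carrier L = UNIV"
    by (auto simp: gf image_image simp flip: onto)
  ultimately have "lie_subquotient (psz_alg :: ('k, 'k psz) lie_alg) L"
    using lie_algebra.subalgebra_carrier[OF assms(3)] unfolding lie_subquotient_def
    by (intro exI[of _ "lie_carrier L"] exI[of _ g] conjI) simp_all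
  then show "L \<notin> EL" by (rule P.not_in_EL)
qed

end
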